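(* Let $c$ be the constraint function of a one-sided one-dimensional kinetically constrained lattice gas. Then there exists $q_0\in(0,1)$ such that for every $q\in(q_0,1)$ the associated diffusion coefficient $D=D(q)$ is strictly positive.
   Context: Let $\Omega=\{0,1\}^{\mathbb{Z}}$ ($0$ = empty site, $1$ = filled site). For $\eta\in\Omega$, $\eta^{xy}=\eta^{x,y}$ is obtained from $\eta$ by exchanging the values at $x$ and $y$, and $(\tau_z\eta)(x)=\eta(x-z)$. A kinetically constrained lattice gas (KCLG) is the Markov process on $\Omega$ with generator $\mathcal{L}f(\eta)=\frac12\sum_{x,y\in\mathbb{Z}}c(x,y,\eta)(f(\eta^{xy})-f(\eta))$, where the constraint function $c:\mathbb{Z}\times\mathbb{Z}\times\Omega\to[0,\infty)$ satisfies: (i) $c(x,y,\eta)=0$ if $|x-y|\neq1$, and $c(x,y,\eta)=c(y,x,\eta)$; (ii) $c(x,y,\eta)=c(x+z,y+z,\tau_z\eta)$ for all $x,y,z$; (iii) $c(x,y,\eta)$ does not depend on $\eta(x),\eta(y)$; in particular $c(x,y,\eta)=c(x,y,\eta^{xy})$; (iv) there is an integer $r>0$ such that $c(x,y,\eta)$ depends only on the restriction of $\eta$ to $x+[-r,r]$; (v) if $\eta(x)\le\omega(x)$ for all $x$, then $c(x,y,\eta)\ge c(x,y,\omega)$ for all $x,y$. For $A\subset\mathbb{Z}$, $\mathbf{1}_A$ is the configuration filled on $A$ and empty elsewhere. The KCLG is one-sided if exactly one of $c(-1,0,\mathbf{1}_{(-\infty,-1]})$ and $c(-1,0,\mathbf{1}_{[0,\infty)})$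 is nonzero. For $q\in(0,1)$, $\mu_q$ is the product over $\mathbb{Z}$ of Bernoulli measures of parameter $1-q$ (each site is empty with probability $q$); the KCLG is reversible with respect to $\mu_q$. The diffusion coefficient at $q$ is given by the standard variational (Green–Kubo) formula $$D(q)=\frac{1}{2q(1-q)}\,\inf_{f}\,\mu_q\left[c(0,1,\eta)\Big(\eta(0)-\eta(1)+\sum_{x\in\mathbb{Z}}\big(f(\tau_x(\eta^{0,1}))-f(\tau_x\eta)\big)\Big)^2\right],$$ where the infimum is over local functions $f:\Omega\to\mathbb{R}$ (functions depending on finitely many sites, so that the sum over $x$ has finitely many nonzero terms). *)

theory Defs
  imports "HOL-Probability.Probability"
begin

(* Configurations: True = filled site (1), False = empty site (0).  The library order on
   functions into bool is the pointwise order of occupation numbers. *)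
type_synonym config = "int \<Rightarrow> bool"

definition exchange :: "int \<Rightarrow> int \<Rightarrow> config \<Rightarrow> config" where
  "exchange x y \<eta> = \<eta>(x := \<eta> y, y := \<eta> x)"

definition shift :: "int \<Rightarrow> config \<Rightarrow> config" where
  "shift z \<eta> = (\<lambda>x. \<eta> (x - z))"

definition filled_on :: "int set \<Rightarrow> config" where
  "filled_on A = (\<lambda>x. x \<in> A)"

(* Constraint functions of kinetically constrained lattice gases.  The process with generator
   L f \<eta> = 1/2 * (\<Sum>x y. c x y \<eta> * (f (exchange x y \<eta>) - f \<eta>))
   is determined by c, and everything below is expressed through c alone. *)
locale kclg =
  fixes c :: "int \<Rightarrow> int \<Rightarrow> config \<Rightarrow> real"
  assumes nonneg: "0 \<le> c x y \<eta>"
    and nearest_neighbour: "\<bar>x - y\<bar> \<noteq> 1 \<Longrightarrow> c x y \<eta> = 0"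
    and symmetric: "c x y \<eta> = c y x \<eta>"
    and translation_invariant: "c x y \<eta> = c (x + z) (y + z) (shift z \<eta>)"
    and endpoint_independent:
      "(\<And>u. u \<noteq> x \<Longrightarrow> u \<noteq> y \<Longrightarrow> \<eta> u = \<omega> u) \<Longrightarrow> c x y \<eta> = c x y \<omega>"
    and finite_range:
      "\<exists>r>0. \<forall>x y \<eta> \<omega>. (\<forall>u\<in>{x - r..x + r}. \<eta> u = \<omega> u) \<longrightarrow> c x y \<eta> = c x y \<omega>"
    and antitone: "\<eta> \<le> \<omega> \<Longrightarrow> c x y \<omega> \<le> c x y \<eta>"

definition one_sided :: "(int \<Rightarrow> int \<Rightarrow> config \<Rightarrow> real) \<Rightarrow> bool" where
  "one_sided c \<longleftrightarrow>
     (c (-1) 0 (filled_on {..-1}) \<noteq> 0 \<and> c (-1) 0 (filled_on {0..}) = 0) \<or>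
     (c (-1) 0 (filled_on {..-1}) = 0 \<and> c (-1) 0 (filled_on {0..}) \<noteq> 0)"

(* q is the probability that a site is empty. *)
definition equilibrium :: "real \<Rightarrow> config measure" where
  "equilibrium q = (\<Pi>\<^sub>M x\<in>UNIV. measure_pmf (bernoulli_pmf (1 - q)))"

definition local_function :: "(config \<Rightarrow> real) \<Rightarrow> bool" where
  "local_function f \<longleftrightarrow>
     (\<exists>A. finite A \<and> (\<forall>\<eta> \<omega>. (\<forall>x\<in>A. \<eta> x = \<omega> x) \<longrightarrow> f \<eta> = f \<omega>))"

(* Green-Kubo variational formula.  For local f only finitely many terms of the sum over x are
   nonzero, so the infinite sum is a finite one; the integrand is then a nonnegative local
   function, so the integral is a finite sum and the infimum is over a set of nonnegative reals. *)
definition diffusion_coefficient :: "(int \<Rightarrow> int \<Rightarrow> config \<Rightarrow> real) \<Rightarrow> real \<Rightarrow> real" where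
  "diffusion_coefficient c q =
     1 / (2 * q * (1 - q)) *
     (INF f\<in>{f. local_function f}.
        \<integral>\<eta>. c 0 1 \<eta> *
             (of_bool (\<eta> 0) - of_bool (\<eta> 1) +
              (\<Sum>\<^sub>\<infinity>x::int. f (shift x (exchange 0 1 \<eta>)) - f (shift x \<eta>)))\<^sup>2
        \<partial>equilibrium q)"

end

theory Submission
  imports Defs
begin

text \<open>Write \<open>G x\<close> for the change of the formal potential \<open>\<Sum>y. y * \<eta> y + \<Sum>z. f (shift z \<eta>)\<close> under
  the exchange of \<open>x\<close> and \<open>x + 1\<close>.  On the one hand the mean of \<open>\<bar>G 0\<bar>\<close> is at least the mean of
  \<open>(\<eta> 0 - \<eta> 1)\<^sup>2\<close>, for every local \<open>f\<close>.  On the other hand the exchange of \<open>0\<close> and \<open>1\<close> can be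
  written as a finite sequence of exchanges that have \<open>r\<close> vacancies to their right, hence rate bounded
  below: pack the particles of a sparse window \<open>[2, 2 + n)\<close> to its right end, exchange, and
  undo the packing.  Exchanges preserve the measure, so Cauchy-Schwarz on each cylinder event bounds the
  mean of \<open>\<bar>G 0\<bar>\<close> by the square root of the Green-Kubo functional times a sum over \<open>n\<close> of
  (number of patterns) * (path length) * (square root of the probability of a pattern).  The shortest
  sparse window has at least about \<open>n / (r + 1)\<close> particles, so this sum converges for \<open>q\<close> near 1.\<close>

subsection \<open>Local functions and the product measure\<close>

lemma local_functionI:
  assumes "finite A" and eq: "\<And>\<eta> \<omega>. (\<And>x. x \<in> A \<Longrightarrow> \<eta> x = \<omega> x) \<Longrightarrow> f \<eta> = f \<omega>"
  shows "local_function f"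
  unfolding local_function_def
proof (intro exI[of _ A] conjI allI impI assms(1))
  fix \<eta> \<omega> :: config
  assume "\<forall>x\<in>A. \<eta> x = \<omega> x"
  then show "f \<eta> = f \<omega>"
    by (intro eq) blast
qed

lemma local_function_const [simp]: "local_function (\<lambda>_. a)"
  by (rule local_functionI[of "{}"]) auto

lemma local_function_site [simp]: "local_function (\<lambda>\<eta>. of_bool (\<eta> x))"
  by (rule local_functionI[of "{x}"]) auto

lemma local_function_cylinder:
  assumes "finite J"
  shows "local_function (\<lambda>\<eta>. of_bool (\<forall>x\<in>J. P x (\<eta> x)))"
  by (rule local_functionI[OF assms]) (simp cong: ball_cong)

lemma local_function_apply2:
  assumes "local_function f" "local_function g"
  shows "local_function (\<lambda>\<eta>. h (f \<eta>) (g \<eta>))"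
proof -
  obtain A where A: "finite A" "\<forall>\<eta> \<omega>. (\<forall>x\<in>A. \<eta> x = \<omega> x) \<longrightarrow> f \<eta> = f \<omega>"
    using assms(1) unfolding local_function_def by (elim exE conjE)
  obtain B where B: "finite B" "\<forall>\<eta> \<omega>. (\<forall>x\<in>B. \<eta> x = \<omega> x) \<longrightarrow> g \<eta> = g \<omega>"
    using assms(2) unfolding local_function_def by (elim exE conjE)
  show ?thesis
  proof (rule local_functionI)
    show "finite (A \<union> B)"
      using A(1) B(1) by simp
    fix \<eta> \<omega> :: config
    assume "\<And>x. x \<in> A \<union> B \<Longrightarrow> \<eta> x = \<omega> x"
    then have "f \<eta> = f \<omega>" "g \<eta> = g \<omega>"
      by (intro A(2)[rule_format] B(2)[rule_format]; blast)+
    then show "h (f \<eta>) (g \<eta>) = h (f \<omega>) (g \<omega>)"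
      by simp
  qed
qed

lemma local_function_apply: "local_function f \<Longrightarrow> local_function (\<lambda>\<eta>. h (f \<eta>))"
  by (rule local_function_apply2[where h = "\<lambda>a _. h a"]) auto

lemma local_function_add [intro]:
  "local_function f \<Longrightarrow> local_function g \<Longrightarrow> local_function (\<lambda>\<eta>. f \<eta> + g \<eta>)"
  by (rule local_function_apply2)

lemma local_function_diff [intro]:
  "local_function f \<Longrightarrow> local_function g \<Longrightarrow> local_function (\<lambda>\<eta>. f \<eta> - g \<eta>)"
  by (rule local_function_apply2)

lemma local_function_mult [intro]:
  "local_function f \<Longrightarrow> local_function g \<Longrightarrow> local_function (\<lambda>\<eta>. f \<eta> * g \<eta>)"
  by (rule local_function_apply2)

lemma local_function_power [intro]: "local_function f \<Longrightarrow> local_function (\<lambda>\<eta>. f \<eta> ^ n)"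
  by (rule local_function_apply)

lemma local_function_abs [intro]: "local_function f \<Longrightarrow> local_function (\<lambda>\<eta>. \<bar>f \<eta>\<bar>)"
  by (rule local_function_apply)

lemma local_function_sum [intro]:
  "(\<And>i. i \<in> I \<Longrightarrow> local_function (f i)) \<Longrightarrow> local_function (\<lambda>\<eta>. \<Sum>i\<in>I. f i \<eta>)"
  by (induction I rule: infinite_finite_induct) auto

text \<open>Exchanges, translations and reflections all act by reindexing sites, so one statement
  covers every transformation used below.\<close>

lemma local_function_reindex:
  assumes "local_function f"
  shows "local_function (\<lambda>\<eta>. f (\<lambda>x. \<eta> (p x)))"
proof -
  obtain A where A: "finite A" "\<forall>\<eta> \<omega>. (\<forall>x\<in>A. \<eta> x = \<omega> x) \<longrightarrow> f \<eta> = f \<omega>"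
    using assms unfolding local_function_def by (elim exE conjE)
  show ?thesis
  proof (rule local_functionI)
    show "finite (p ` A)"
      using A(1) by simp
    fix \<eta> \<omega> :: config
    assume "\<And>x. x \<in> p ` A \<Longrightarrow> \<eta> x = \<omega> x"
    then show "f (\<lambda>x. \<eta> (p x)) = f (\<lambda>x. \<omega> (p x))"
      by (intro A(2)[rule_format]) blast
  qed
qed

lemma exchange_reindex: "exchange x y \<eta> = (\<lambda>u. \<eta> (Transposition.transpose x y u))"
  by (auto simp: exchange_def Transposition.transpose_def fun_eq_iff)

lemma local_function_exchange [intro]:
  "local_function f \<Longrightarrow> local_function (\<lambda>\<eta>. f (exchange x y \<eta>))"
  unfolding exchange_reindex by (rule local_function_reindex)

lemma local_function_shift [intro]:
  "local_function f \<Longrightarrow> local_function (\<lambda>\<eta>. f (shift z \<eta>))"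
  unfolding shift_def by (rule local_function_reindex)

text \<open>A function of the sites in \<open>A\<close> takes no values beyond those at
  \<open>filled_on B\<close> with \<open>B\<close> a subset of \<open>A\<close>. Boundedness
  follows.\<close>

lemma local_function_finite_range:
  assumes "local_function f"
  shows "finite (range f)"
proof -
  obtain A where A: "finite A" "\<forall>\<eta> \<omega>. (\<forall>x\<in>A. \<eta> x = \<omega> x) \<longrightarrow> f \<eta> = f \<omega>"
    using assms unfolding local_function_def by (elim exE conjE)
  have "range f \<subseteq> (\<lambda>B. f (filled_on B)) ` Pow A"
  proof
    fix y assume "y \<in> range f"
    then obtain \<eta> where "y = f \<eta>" by auto
    also have "f \<eta> = f (filled_on {x\<in>A. \<eta> x})"
      by (rule A(2)[rule_format]) (auto simp: filled_on_def)
    finally show "y \<in> (\<lambda>B. f (filled_on B)) ` Pow A"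
      by auto
  qed
  then show ?thesis
    by (rule finite_subset) (simp add: A(1))
qed

lemma local_function_bounded:
  assumes "local_function f"
  obtains B where "0 \<le> B" "\<And>\<eta>. \<bar>f \<eta>\<bar> \<le> B"
proof
  have fin: "finite (range (\<lambda>\<eta>. \<bar>f \<eta>\<bar>))"
    by (rule local_function_finite_range) (rule local_function_abs[OF assms])
  show le: "\<bar>f \<eta>\<bar> \<le> Max (range (\<lambda>\<eta>. \<bar>f \<eta>\<bar>))" for \<eta>
    by (rule Max_ge[OF fin]) simp
  show "0 \<le> Max (range (\<lambda>\<eta>. \<bar>f \<eta>\<bar>))"
    using le[of undefined] by simp
qed

section \<open>The Bernoulli product measure: measurability, invariance, cylinder
  probabilities\<close>

lemma product_prob_space_bernoulli:
  "product_prob_space (\<lambda>_::int. measure_pmf (bernoulli_pmf (1 - q)))"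
  by unfold_locales

lemma space_equilibrium [simp]: "space (equilibrium q) = UNIV"
  by (simp add: equilibrium_def space_PiM PiE_UNIV_domain)

lemma prob_space_equilibrium: "prob_space (equilibrium q)"
proof -
  interpret product_prob_space "\<lambda>_::int. measure_pmf (bernoulli_pmf (1 - q))"
    by (rule product_prob_space_bernoulli)
  show ?thesis
    unfolding equilibrium_def by (rule prob_space_PiM) (rule measure_pmf.prob_space_axioms)
qed

lemma site_measurable:
  "(\<lambda>\<eta>. \<eta> x) \<in> measurable (equilibrium q) (count_space UNIV)"
proof -
  have "(\<lambda>\<eta>. \<eta> x) \<in> measurable (equilibrium q) (measure_pmf (bernoulli_pmf (1 - q)))"
    unfolding equilibrium_def by (rule measurable_component_singleton) simp
  then show ?thesis
    by simp
qed

lemma cylinder_sets: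
  assumes "finite J"
  shows "{\<eta>. \<forall>x\<in>J. \<eta> x \<longleftrightarrow> x \<in> A} \<in> sets (equilibrium q)"
proof -
  have site: "{\<eta>. \<eta> x \<longleftrightarrow> b} \<in> sets (equilibrium q)" for x b
    using measurable_sets[OF site_measurable, of "{b}" x q] by (simp add: vimage_def)
  have "{\<eta>\<in>space (equilibrium q). \<forall>x\<in>J. \<eta> x \<longleftrightarrow> x \<in> A} \<in> sets (equilibrium q)"
    using assms site by (intro sets.sets_Collect_finite_All) auto
  then show ?thesis
    by simp
qed

text \<open>Expanding over the patterns \<open>B\<close> on \<open>A\<close> writes \<open>f\<close>
  as a finite linear combination of cylinder indicators.\<close>

lemma local_function_measurable:
  assumes "local_function f"
  shows "f \<in> borel_measurable (equilibrium q)"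
proof -
  obtain A where A: "finite A" "\<forall>\<eta> \<omega>. (\<forall>x\<in>A. \<eta> x = \<omega> x) \<longrightarrow> f \<eta> = f \<omega>"
    using assms unfolding local_function_def by (elim exE conjE)
  have "f \<eta> = (\<Sum>B\<in>Pow A. f (filled_on B) * indicator {\<eta>. \<forall>x\<in>A. \<eta> x \<longleftrightarrow> x \<in> B} \<eta>)" for \<eta>
  proof -
    have "indicator {\<eta>. \<forall>x\<in>A. \<eta> x \<longleftrightarrow> x \<in> B} \<eta> = (of_bool (B = {x\<in>A. \<eta> x}) :: real)"
      if "B \<in> Pow A" for B
      using that by (auto simp: indicator_def)
    then have "(\<Sum>B\<in>Pow A. f (filled_on B) * indicator {\<eta>. \<forall>x\<in>A. \<eta> x \<longleftrightarrow> x \<in> B} \<eta>) =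
        (\<Sum>B\<in>Pow A. if B = {x\<in>A. \<eta> x} then f (filled_on B) else 0)"
      by (intro sum.cong) auto
    also have "\<dots> = f (filled_on {x\<in>A. \<eta> x})"
      using A(1) by (simp add: sum.delta)
    also have "\<dots> = f \<eta>"
      by (rule A(2)[rule_format]) (auto simp: filled_on_def)
    finally show ?thesis by simp
  qed
  then have "f = (\<lambda>\<eta>. \<Sum>B\<in>Pow A. f (filled_on B) * indicator {\<eta>. \<forall>x\<in>A. \<eta> x \<longleftrightarrow> x \<in> B} \<eta>)"
    by blast
  moreover have "\<dots> \<in> borel_measurable (equilibrium q)"
    using A(1) by (intro borel_measurable_sum borel_measurable_times borel_measurable_indicator
        cylinder_sets) auto
  ultimately show ?thesis by simp
qed

lemma local_function_integrable:
  assumes "local_function f"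
  shows "integrable (equilibrium q) f"
proof -
  interpret prob_space "equilibrium q" by (rule prob_space_equilibrium)
  obtain B where "\<And>\<eta>. \<bar>f \<eta>\<bar> \<le> B"
    using local_function_bounded[OF assms] by blast
  then show ?thesis
    by (intro integrable_const_bound[of _ B] local_function_measurable assms) auto
qed

text \<open>The occupation numbers are i.i.d., so permuting the sites preserves their law. This one
  fact gives reversibility under exchanges, translation invariance and reflection
  invariance.\<close>

lemma integral_equilibrium_reindex:
  assumes "bij p" "local_function f"
  shows "(\<integral>\<eta>. f (\<lambda>x. \<eta> (p x)) \<partial>equilibrium q) = (\<integral>\<eta>. f \<eta> \<partial>equilibrium q)"
proof -
  let ?B = "\<lambda>_::int. measure_pmf (bernoulli_pmf (1 - q))"
  have distr: "distr (equilibrium q) (equilibrium q) (\<lambda>\<eta> x. \<eta> (p x)) = equilibrium q"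
  proof -
    have "distr (Pi\<^sub>M UNIV ?B) (Pi\<^sub>M UNIV (\<lambda>i. ?B (p i))) (\<lambda>\<eta>. \<lambda>x\<in>UNIV. \<eta> (p x)) =
        Pi\<^sub>M UNIV (\<lambda>i. ?B (p i))"
      by (rule distr_PiM_reindex)
        (auto intro: measure_pmf.prob_space_axioms bij_is_inj[OF assms(1)])
    then show ?thesis
      by (simp only: restrict_UNIV equilibrium_def)
  qed
  have "(\<lambda>\<eta> x. \<eta> (p x)) \<in> measurable (equilibrium q) (equilibrium q)"
    unfolding equilibrium_def
  proof (rule measurable_PiM_single')
    show "(\<lambda>\<eta>. \<eta> (p i)) \<in> measurable (Pi\<^sub>M UNIV ?B) (?B i)" for i
      by (rule measurable_component_singleton) simp
  qed (simp add: PiE_UNIV_domain)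
  then have "(\<integral>\<eta>. f \<eta> \<partial>distr (equilibrium q) (equilibrium q) (\<lambda>\<eta> x. \<eta> (p x))) =
      (\<integral>\<eta>. f (\<lambda>x. \<eta> (p x)) \<partial>equilibrium q)"
    by (rule integral_distr) (rule local_function_measurable[OF assms(2)])
  then show ?thesis
    unfolding distr by simp
qed

lemma integral_equilibrium_exchange:
  "local_function f \<Longrightarrow>
    (\<integral>\<eta>. f (exchange x y \<eta>) \<partial>equilibrium q) = (\<integral>\<eta>. f \<eta> \<partial>equilibrium q)"
  unfolding exchange_reindex by (rule integral_equilibrium_reindex) simp_all

lemma integral_equilibrium_shift:
  "local_function f \<Longrightarrow>
    (\<integral>\<eta>. f (shift z \<eta>) \<partial>equilibrium q) = (\<integral>\<eta>. f \<eta> \<partial>equilibrium q)"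
  unfolding shift_def by (rule integral_equilibrium_reindex)
    (simp_all add: bij_betw_byWitness[where f' = "\<lambda>x. x + z"])

lemma integral_cylinder:
  assumes "0 < q" "q < 1" "finite J"
  shows "(\<integral>\<eta>. of_bool (\<forall>x\<in>J. \<eta> x \<longleftrightarrow> x \<in> A) \<partial>equilibrium q) =
    (\<Prod>x\<in>J. if x \<in> A then 1 - q else q)"
proof -
  interpret product_prob_space "\<lambda>_::int. measure_pmf (bernoulli_pmf (1 - q))" UNIV
    by (rule product_prob_space_bernoulli)
  let ?E = "{\<eta>. \<forall>x\<in>J. \<eta> x \<longleftrightarrow> x \<in> A}"
  have "(\<lambda>\<eta>. of_bool (\<forall>x\<in>J. \<eta> x \<longleftrightarrow> x \<in> A)) = (indicator ?E :: config \<Rightarrow> real)"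
    by (simp add: indicator_def fun_eq_iff)
  then have "(\<integral>\<eta>. of_bool (\<forall>x\<in>J. \<eta> x \<longleftrightarrow> x \<in> A) \<partial>equilibrium q) =
      measure (equilibrium q) ?E"
    by simp
  moreover have "?E = prod_emb UNIV (\<lambda>_. measure_pmf (bernoulli_pmf (1 - q))) J (Pi\<^sub>E J (\<lambda>x. {x \<in> A}))"
  proof (rule set_eqI)
    fix \<eta>
    show "\<eta> \<in> ?E \<longleftrightarrow>
        \<eta> \<in> prod_emb UNIV (\<lambda>_. measure_pmf (bernoulli_pmf (1 - q))) J (Pi\<^sub>E J (\<lambda>x. {x \<in> A}))"
      unfolding prod_emb_iff PiE_iff by simp
  qed
  moreover have "measure (equilibrium q)
      (prod_emb UNIV (\<lambda>_. measure_pmf (bernoulli_pmf (1 - q))) J (Pi\<^sub>E J (\<lambda>x. {x \<in> A}))) =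
      (\<Prod>x\<in>J. measure (measure_pmf (bernoulli_pmf (1 - q))) {x \<in> A})"
    unfolding equilibrium_def by (rule measure_PiM_emb) (use assms(3) in simp_all)
  moreover have "\<dots> = (\<Prod>x\<in>J. if x \<in> A then 1 - q else q)"
  proof (rule prod.cong[OF refl])
    fix x
    show "measure (measure_pmf (bernoulli_pmf (1 - q))) {x \<in> A} = (if x \<in> A then 1 - q else q)"
      using assms by (cases "x \<in> A") (simp_all add: measure_pmf_single)
  qed
  ultimately show ?thesis
    by (simp only:)
qed

text \<open>Each vacant site contributes a factor \<open>q\<close>, which is at most 1 and is
  dropped; only the particles are paid for.\<close>

lemma integral_cylinder_le:
  assumes "0 < q" "q < 1" "finite J" "A \<subseteq> J"
  shows "(\<integral>\<eta>. of_bool (\<forall>x\<in>J. \<eta> x \<longleftrightarrow> x \<in> A) \<partial>equilibrium q) \<le> (1 - q) ^ card A"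
proof -
  have "(\<Prod>x\<in>J. if x \<in> A then 1 - q else q) =
      (\<Prod>x\<in>A. if x \<in> A then 1 - q else q) * (\<Prod>x\<in>J - A. if x \<in> A then 1 - q else q)"
    using prod.subset_diff[OF assms(4,3), of "\<lambda>x. if x \<in> A then 1 - q else q"]
    by (simp only: mult.commute)
  also have "(\<Prod>x\<in>A. if x \<in> A then 1 - q else q) = (1 - q) ^ card A"
    by simp
  also have "(1 - q) ^ card A * (\<Prod>x\<in>J - A. if x \<in> A then 1 - q else q) \<le> (1 - q) ^ card A * 1"
    using assms by (intro mult_left_mono prod_le_1) auto
  finally show ?thesis
    using integral_cylinder[OF assms(1-3)] by simp
qed

lemma integral_Cauchy_Schwarz:
  assumes "local_function u" "local_function v"
  shows "(\<integral>\<eta>. \<bar>u \<eta> * v \<eta>\<bar> \<partial>equilibrium q) \<le>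
    sqrt (\<integral>\<eta>. (u \<eta>)\<^sup>2 \<partial>equilibrium q) * sqrt (\<integral>\<eta>. (v \<eta>)\<^sup>2 \<partial>equilibrium q)"
    (is "?I \<le> sqrt ?a * sqrt ?b")
proof -
  have nn: "0 \<le> ?a" "0 \<le> ?b" by auto
  have int: "integrable (equilibrium q) (\<lambda>\<eta>. (u \<eta>)\<^sup>2)" "integrable (equilibrium q) (\<lambda>\<eta>. (v \<eta>)\<^sup>2)"
    "integrable (equilibrium q) (\<lambda>\<eta>. \<bar>u \<eta> * v \<eta>\<bar>)"
    using assms by (auto intro!: local_function_integrable)
  \<comment> \<open>Young's inequality with free weights \<open>s\<close> and \<open>t\<close>,
    integrated. The weights \<open>sqrt ?a\<close> and \<open>sqrt ?b\<close> give the claim when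
    both are positive.\<close>
  have young: "2 * s * t * ?I \<le> t\<^sup>2 * ?a + s\<^sup>2 * ?b" for s t :: real
  proof -
    have "(\<integral>\<eta>. 2 * s * t * \<bar>u \<eta> * v \<eta>\<bar> \<partial>equilibrium q) \<le>
        (\<integral>\<eta>. t\<^sup>2 * (u \<eta>)\<^sup>2 + s\<^sup>2 * (v \<eta>)\<^sup>2 \<partial>equilibrium q)"
    proof (rule integral_mono)
      show "2 * s * t * \<bar>u \<eta> * v \<eta>\<bar> \<le> t\<^sup>2 * (u \<eta>)\<^sup>2 + s\<^sup>2 * (v \<eta>)\<^sup>2" for \<eta>
        using zero_le_power2[of "t * \<bar>u \<eta>\<bar> - s * \<bar>v \<eta>\<bar>"]
        by (simp add: power2_diff power_mult_distrib abs_mult algebra_simps)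
    qed (use int in auto)
    then show ?thesis
      using int by simp
  qed
  have I0: "0 \<le> ?I"
    by simp
  show ?thesis
  proof (cases "?a = 0 \<or> ?b = 0")
    case False
    then have pos: "0 < sqrt ?a * sqrt ?b"
      using nn by (simp add: less_le)
    have "2 * (sqrt ?a * sqrt ?b) * ?I \<le> 2 * (sqrt ?a * sqrt ?b) * (sqrt ?a * sqrt ?b)"
      using young[of "sqrt ?a" "sqrt ?b"] nn by (simp add: algebra_simps)
    then show ?thesis
      using pos by (simp add: mult_le_cancel_left_pos)
  next
    \<comment> \<open>Here a square root vanishes and those weights give nothing. Taking
      \<open>?I\<close> itself as one weight bounds a positive multiple of \<open>?I\<^sup>2\<close>
      by 0.\<close>
    case True
    then consider "?a = 0" | "?b = 0" by blast
    then have "?I\<^sup>2 \<le> 0"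
    proof cases
      case 1
      have "?I\<^sup>2 * (?b + 2) \<le> 0"
        using young[of ?I "?b + 1"] 1 by (simp add: power2_eq_square algebra_simps)
      then show ?thesis
        using nn by (simp add: mult_le_0_iff)
    next
      case 2
      have "?I\<^sup>2 * (?a + 2) \<le> 0"
        using young[of "?a + 1" ?I] 2 by (simp add: power2_eq_square algebra_simps)
      then show ?thesis
        using nn by (simp add: mult_le_0_iff)
    qed
    then have "?I = 0" by simp
    then show ?thesis using nn by simp
  qed
qed

subsection \<open>Paths of facilitated exchanges\<close>

definition vacant_right :: "nat \<Rightarrow> int \<Rightarrow> config \<Rightarrow> bool" where
  "vacant_right r x \<eta> \<longleftrightarrow> (\<forall>k\<in>{x + 2..x + 1 + int r}. \<not> \<eta> k)"

fun run_path :: "int list \<Rightarrow> config \<Rightarrow> config" where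
  "run_path [] \<eta> = \<eta>"
| "run_path (x # xs) \<eta> = run_path xs (exchange x (x + 1) \<eta>)"

fun allowed_path :: "nat \<Rightarrow> int list \<Rightarrow> config \<Rightarrow> bool" where
  "allowed_path r [] \<eta> \<longleftrightarrow> True"
| "allowed_path r (x # xs) \<eta> \<longleftrightarrow>
     vacant_right r x \<eta> \<and> allowed_path r xs (exchange x (x + 1) \<eta>)"

lemma exchange_exchange [simp]: "exchange x y (exchange x y \<eta>) = \<eta>"
  by (auto simp: exchange_def)

lemma vacant_right_exchange [simp]:
  "vacant_right r x (exchange x (x + 1) \<eta>) \<longleftrightarrow> vacant_right r x \<eta>"
  by (auto simp: vacant_right_def exchange_def)

lemma run_path_append [simp]: "run_path (xs @ ys) \<eta> = run_path ys (run_path xs \<eta>)"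
  by (induction xs arbitrary: \<eta>) auto

lemma allowed_path_append [simp]:
  "allowed_path r (xs @ ys) \<eta> \<longleftrightarrow> allowed_path r xs \<eta> \<and> allowed_path r ys (run_path xs \<eta>)"
  by (induction xs arbitrary: \<eta>) auto

lemma run_path_rev [simp]: "run_path (rev xs) (run_path xs \<eta>) = \<eta>"
  by (induction xs arbitrary: \<eta>) auto

text \<open>An exchange is an involution and does not touch the sites that facilitate it, so it
  remains facilitated when undone.\<close>

lemma allowed_path_rev:
  "allowed_path r xs \<eta> \<Longrightarrow> allowed_path r (rev xs) (run_path xs \<eta>)"
  by (induction xs arbitrary: \<eta>) auto

text \<open>Bonds starting at 2 or beyond are disjoint from the bond of 0 and 1. This lets a packing
  path be undone after 0 and 1 have been exchanged.\<close>

lemma run_path_exchange_commute: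
  assumes "\<And>x. x \<in> set xs \<Longrightarrow> 2 \<le> x"
  shows "run_path xs (exchange 0 1 \<eta>) = exchange 0 1 (run_path xs \<eta>)"
  using assms
proof (induction xs arbitrary: \<eta>)
  case (Cons x xs)
  have "exchange x (x + 1) (exchange 0 1 \<eta>) = exchange 0 1 (exchange x (x + 1) \<eta>)"
    using Cons.prems[of x] by (auto simp: exchange_def fun_eq_iff)
  then show ?case
    using Cons by simp
qed simp

text \<open>Each hop enters a vacant site and needs \<open>r\<close> more vacancies beyond it, so
  \<open>d\<close> hops stay within the \<open>d + r\<close> vacancies assumed ahead of the
  particle.\<close>

lemma move_particle_right:
  assumes "\<eta> x" and "\<And>k. x < k \<Longrightarrow> k \<le> x + int d + int r \<Longrightarrow> \<not> \<eta> k"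
  shows "allowed_path r [x..x + int d - 1] \<eta> \<and>
    run_path [x..x + int d - 1] \<eta> = \<eta>(x := False, x + int d := True)"
  using assms
proof (induction d arbitrary: x \<eta>)
  case 0
  then show ?case by auto
next
  case (Suc d)
  have list: "[x..x + int (Suc d) - 1] = x # [x + 1..(x + 1) + int d - 1]"
    by (subst upto_rec1) (auto simp: algebra_simps)
  let ?\<eta> = "exchange x (x + 1) \<eta>"
  have "?\<eta> (x + 1)"
    by (simp add: exchange_def Suc.prems(1))
  moreover have "\<not> ?\<eta> k" if "x + 1 < k" "k \<le> x + 1 + int d + int r" for k
    using that Suc.prems(2)[of k] by (simp add: exchange_def)
  ultimately have "allowed_path r [x + 1..(x + 1) + int d - 1] ?\<eta> \<and>
      run_path [x + 1..(x + 1) + int d - 1] ?\<eta> = ?\<eta>(x + 1 := False, x + 1 + int d := True)"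
    by (rule Suc.IH)
  moreover have "vacant_right r x \<eta>"
    unfolding vacant_right_def using Suc.prems(2) by auto
  moreover have "?\<eta>(x + 1 := False, x + 1 + int d := True) = \<eta>(x := False, x + int (Suc d) := True)"
    using Suc.prems(1) Suc.prems(2)[of "x + 1"] by (auto simp: exchange_def fun_eq_iff algebra_simps)
  ultimately show ?case
    unfolding list by simp
qed

text \<open>Induction on the window length, adding one site \<open>a\<close> at the left end. If
  \<open>a\<close> is vacant the old path still works. If it is filled, the \<open>k\<close>
  particles further right are already packed into the last \<open>(r + 1) * k\<close> sites, and the
  new particle moves up behind them. The path is chosen before \<open>\<eta>\<close>, because a
  single path must serve the whole cylinder event.\<close>

lemma pack_particles_right:
  fixes b :: int and A :: config
  assumes "\<And>j. j \<le> n \<Longrightarrow> (r + 1) * card {x\<in>{b - int j..<b}. A x} \<le> j"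
  shows "\<exists>xs. length xs \<le> n * n \<and> set xs \<subseteq> {b - int n..<b} \<and>
    (\<forall>\<eta>. (\<forall>x\<in>{b - int n..<b}. \<eta> x = A x) \<longrightarrow>
      allowed_path r xs \<eta> \<and>
      (\<forall>x. x \<notin> {b - int n..<b} \<longrightarrow> run_path xs \<eta> x = \<eta> x) \<and>
      (\<forall>x. b - int n \<le> x \<longrightarrow> x < b - int ((r + 1) * card {x\<in>{b - int n..<b}. A x}) \<longrightarrow>
        \<not> run_path xs \<eta> x))"
  using assms
proof (induction n)
  case 0
  show ?case
    by (intro exI[of _ "[]"]) auto
next
  case (Suc n)
  define k where "k = card {x\<in>{b - int n..<b}. A x}"
  define a where "a = b - int (Suc n)"
  have win: "{b - int (Suc n)..<b} = insert a {b - int n..<b}"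
    by (auto simp: a_def)
  have "\<exists>xs. length xs \<le> n * n \<and> set xs \<subseteq> {b - int n..<b} \<and>
    (\<forall>\<eta>. (\<forall>x\<in>{b - int n..<b}. \<eta> x = A x) \<longrightarrow>
      allowed_path r xs \<eta> \<and>
      (\<forall>x. x \<notin> {b - int n..<b} \<longrightarrow> run_path xs \<eta> x = \<eta> x) \<and>
      (\<forall>x. b - int n \<le> x \<longrightarrow> x < b - int ((r + 1) * k) \<longrightarrow> \<not> run_path xs \<eta> x))"
    unfolding k_def by (rule Suc.IH, rule Suc.prems) simp
  then obtain xs where xs: "length xs \<le> n * n" "set xs \<subseteq> {b - int n..<b}"
    and X: "\<forall>\<eta>. (\<forall>x\<in>{b - int n..<b}. \<eta> x = A x) \<longrightarrow>
      allowed_path r xs \<eta> \<and>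
      (\<forall>x. x \<notin> {b - int n..<b} \<longrightarrow> run_path xs \<eta> x = \<eta> x) \<and>
      (\<forall>x. b - int n \<le> x \<longrightarrow> x < b - int ((r + 1) * k) \<longrightarrow> \<not> run_path xs \<eta> x)"
    by (elim exE conjE)
  note run = X[THEN spec, THEN mp, THEN conjunct1]
    X[THEN spec, THEN mp, THEN conjunct2, THEN conjunct1, THEN spec, THEN mp]
    X[THEN spec, THEN mp, THEN conjunct2, THEN conjunct2, THEN spec, THEN mp, THEN mp]
  have a_out: "a \<notin> {b - int n..<b}"
    by (auto simp: a_def)
  show ?case
  proof (cases "A a")
    case False
    then have eq: "{x\<in>{b - int (Suc n)..<b}. A x} = {x\<in>{b - int n..<b}. A x}"
      unfolding win by auto
    show ?thesis
      unfolding eq k_def[symmetric]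
    proof (intro exI[of _ xs] conjI allI impI)
      show "length xs \<le> Suc n * Suc n"
        using xs(1) by simp
      show "set xs \<subseteq> {b - int (Suc n)..<b}"
        using xs(2) unfolding win by auto
      fix \<eta> :: config
      assume \<eta>: "\<forall>x\<in>{b - int (Suc n)..<b}. \<eta> x = A x"
      then have \<eta>': "\<forall>x\<in>{b - int n..<b}. \<eta> x = A x"
        unfolding win by auto
      show "allowed_path r xs \<eta>"
        by (rule run(1)[OF \<eta>'])
      show "run_path xs \<eta> x = \<eta> x" if "x \<notin> {b - int (Suc n)..<b}" for x
        using that run(2)[OF \<eta>'] unfolding win by auto
      show "\<not> run_path xs \<eta> x"
        if "b - int (Suc n) \<le> x" "x < b - int ((r + 1) * k)" for x
      proof (cases "x = a")
        case True
        then show ?thesis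
          using run(2)[OF \<eta>' a_out] \<eta> False unfolding win by auto
      next
        case False
        then show ?thesis
          using run(3)[OF \<eta>', of x] that by (auto simp: a_def)
      qed
    qed
  next
    case True
    then have eq: "{x\<in>{b - int (Suc n)..<b}. A x} = insert a {x\<in>{b - int n..<b}. A x}"
      unfolding win by auto
    have card: "card {x\<in>{b - int (Suc n)..<b}. A x} = Suc k"
      unfolding eq k_def
    proof (rule card_insert_disjoint)
      show "finite {x\<in>{b - int n..<b}. A x}"
        by (rule finite_subset[of _ "{b - int n..<b}"]) auto
      show "a \<notin> {x\<in>{b - int n..<b}. A x}"
        using a_out by blast
    qed
    then have le: "(r + 1) * Suc k \<le> Suc n"
      using Suc.prems[of "Suc n"] by simp
    \<comment> \<open>The particle travels from \<open>a\<close> to \<open>e\<close>, where exactly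
      \<open>r\<close> sites separate it from the packed block. Sparsity of the full window,
      \<open>le\<close>, ensures that the subtraction is not truncated.\<close>
    define d where "d = Suc n - (r + 1) * Suc k"
    define e where "e = a + int d"
    have target: "e = b - int ((r + 1) * Suc k)"
    proof -
      have "int d = int (Suc n) - int ((r + 1) * Suc k)"
        using le unfolding d_def by (rule of_nat_diff)
      then show ?thesis
        unfolding e_def a_def by linarith
    qed
    have "int ((r + 1) * Suc k) = int ((r + 1) * k) + int r + 1"
      by (simp add: algebra_simps)
    then have er: "e + int r < b - int ((r + 1) * k)"
      unfolding target by linarith
    then have eb: "e < b"
      by linarith
    have ae: "a \<le> e"
      unfolding e_def by simp
    have a1: "b - int n = a + 1" and a0: "b - int (Suc n) = a"
      by (auto simp: a_def)
    let ?ys = "[a..e - 1]"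
    show ?thesis
      unfolding card target[symmetric] unfolding a0
    proof (intro exI[of _ "xs @ ?ys"] conjI allI impI)
      \<comment> \<open>The quadratic length bound closes because n^2 + (n + 1) is at most (n +
        1)^2.\<close>
      have "length ?ys \<le> Suc n"
        by (simp add: d_def e_def)
      then show "length (xs @ ?ys) \<le> Suc n * Suc n"
        using xs(1) by simp
      show "set (xs @ ?ys) \<subseteq> {a..<b}"
        using xs(2) eb unfolding a1 by auto
      fix \<eta> :: config
      assume \<eta>: "\<forall>x\<in>{a..<b}. \<eta> x = A x"
      then have \<eta>': "\<forall>x\<in>{b - int n..<b}. \<eta> x = A x"
        unfolding a1 by auto
      let ?\<zeta> = "run_path xs \<eta>"
      have "\<eta> a"
        using \<eta> True ae eb by auto
      then have \<zeta>a: "?\<zeta> a"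
        using run(2)[OF \<eta>' a_out] by simp
      have vac: "\<not> ?\<zeta> x" if "a < x" "x \<le> e + int r" for x
        by (rule run(3)[OF \<eta>']) (use that er in \<open>auto simp: a1\<close>)
      have packed: "allowed_path r ?ys ?\<zeta> \<and> run_path ?ys ?\<zeta> = ?\<zeta>(a := False, e := True)"
        using move_particle_right[of ?\<zeta> a d r, OF \<zeta>a] vac unfolding e_def by blast
      then show "allowed_path r (xs @ ?ys) \<eta>"
        using run(1)[OF \<eta>'] by simp
      have run_ys: "run_path (xs @ ?ys) \<eta> = ?\<zeta>(a := False, e := True)"
        using packed by simp
      show "run_path (xs @ ?ys) \<eta> x = \<eta> x" if "x \<notin> {a..<b}" for x
      proof -
        have "x \<noteq> e" "x \<noteq> a" "x \<notin> {b - int n..<b}"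
          using that ae eb unfolding a1 by auto
        then show ?thesis
          unfolding run_ys using run(2)[OF \<eta>'] by simp
      qed
      show "\<not> run_path (xs @ ?ys) \<eta> x" if "a \<le> x" and "x < e" for x
        using that vac[of x] unfolding run_ys by auto
    qed
  qed
qed

text \<open>A filled set stops at length \<open>n\<close> when \<open>n\<close> is the first length for which the window
  \<open>[2, 2 + n)\<close> has room for its particles with \<open>r\<close> vacancies to the right of each and \<open>r\<close> more at the
  left end.  Minimality forces every right end of the window to be sparse as well.\<close>

definition stopping :: "nat \<Rightarrow> nat \<Rightarrow> int set \<Rightarrow> bool" where
  "stopping r n A \<longleftrightarrow> (r + 1) * card A + r \<le> n \<and>
     (\<forall>j<n. j < (r + 1) * card (A \<inter> {2..<2 + int j}) + r)"

text \<open>Conjugation: pack the window, exchange 0 and 1, unpack by the reversed path. The surplus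
  \<open>r\<close> in the stopping condition leaves the sites from 2 to \<open>r + 1\<close> vacant
  after packing, which is exactly what facilitates the middle exchange.\<close>

lemma exchange_path:
  assumes A: "A \<subseteq> {2..<2 + int n}" and stop: "stopping r n A"
  shows "\<exists>xs. length xs \<le> 2 * n\<^sup>2 + 1 \<and> set xs \<subseteq> {0..<2 + int n} \<and>
    (\<forall>\<eta>. (\<forall>x\<in>{2..<2 + int n}. \<eta> x \<longleftrightarrow> x \<in> A) \<longrightarrow>
      allowed_path r xs \<eta> \<and> run_path xs \<eta> = exchange 0 1 \<eta>)"
proof -
  define b where "b = 2 + int n"
  have fin: "finite A"
    using A finite_subset by blast
  \<comment> \<open>Cut off the last \<open>j\<close> sites. By minimality the remaining
    \<open>n - j\<close> sites are too crowded, while the full window has room, so the last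
    \<open>j\<close> sites must be sparse. Minimality says nothing about length \<open>n\<close>
    itself, hence the separate case \<open>j = 0\<close>.\<close>
  have sparse: "(r + 1) * card {x\<in>{b - int j..<b}. x \<in> A} \<le> j" if "j \<le> n" for j
  proof (cases "j = 0")
    case False
    have split: "A = A \<inter> {2..<2 + int (n - j)} \<union> {x\<in>{b - int j..<b}. x \<in> A}"
      using A that by (auto simp: b_def of_nat_diff)
    have "card A = card (A \<inter> {2..<2 + int (n - j)}) + card {x\<in>{b - int j..<b}. x \<in> A}"
      by (subst split, rule card_Un_disjoint) (use fin that in \<open>auto simp: b_def of_nat_diff\<close>)
    then have "(r + 1) * card A = (r + 1) * card (A \<inter> {2..<2 + int (n - j)}) +
        (r + 1) * card {x\<in>{b - int j..<b}. x \<in> A}"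
      by (simp only: distrib_left)
    moreover have "n - j < (r + 1) * card (A \<inter> {2..<2 + int (n - j)}) + r"
      using stop False that unfolding stopping_def by (meson diff_less less_le_trans not_gr0)
    moreover have "(r + 1) * card A + r \<le> n"
      using stop unfolding stopping_def by simp
    ultimately show ?thesis
      by linarith
  qed auto
  have win: "{b - int n..<b} = {2..<2 + int n}"
    by (simp add: b_def)
  have cardA: "{x\<in>{2..<2 + int n}. x \<in> A} = A"
    using A by auto
  obtain xs where xs: "length xs \<le> n * n" "set xs \<subseteq> {2..<2 + int n}"
    and run: "\<And>\<eta>. (\<forall>x\<in>{2..<2 + int n}. \<eta> x \<longleftrightarrow> x \<in> A) \<Longrightarrow> allowed_path r xs \<eta>"
      "\<And>\<eta> x. (\<forall>x\<in>{2..<2 + int n}. \<eta> x \<longleftrightarrow> x \<in> A) \<Longrightarrow> 2 \<le> x \<Longrightarrow>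
          x < b - int ((r + 1) * card A) \<Longrightarrow> \<not> run_path xs \<eta> x"
    using pack_particles_right[of n r b "\<lambda>x. x \<in> A", OF sparse] unfolding win cardA
    by (auto simp: b_def)
  show ?thesis
  proof (intro exI[of _ "xs @ [0] @ rev xs"] conjI allI impI)
    show "length (xs @ [0] @ rev xs) \<le> 2 * n\<^sup>2 + 1"
      using xs(1) by (simp add: power2_eq_square)
    show "set (xs @ [0] @ rev xs) \<subseteq> {0..<2 + int n}"
      using xs(2) by auto
    fix \<eta> :: config
    assume \<eta>: "\<forall>x\<in>{2..<2 + int n}. \<eta> x \<longleftrightarrow> x \<in> A"
    \<comment> \<open>The exchanged configuration has the same pattern on the window, so the same
      path packs it and its reverse unpacks it.\<close>
    then have \<eta>': "\<forall>x\<in>{2..<2 + int n}. exchange 0 1 \<eta> x \<longleftrightarrow> x \<in> A"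
      by (auto simp: exchange_def)
    have comm: "exchange 0 1 (run_path xs \<eta>) = run_path xs (exchange 0 1 \<eta>)"
      by (rule run_path_exchange_commute[symmetric]) (use xs(2) in auto)
    have "vacant_right r 0 (run_path xs \<eta>)"
      unfolding vacant_right_def
    proof
      fix k assume k: "k \<in> {0 + 2..0 + 1 + int r}"
      have "(r + 1) * card A + r \<le> n"
        using stop unfolding stopping_def by simp
      then have "int ((r + 1) * card A) + int r \<le> int n"
        by (simp only: of_nat_add[symmetric] of_nat_le_iff)
      with k show "\<not> run_path xs \<eta> k"
        by (intro run(2)[OF \<eta>]) (auto simp: b_def)
    qed
    then show "allowed_path r (xs @ [0] @ rev xs) \<eta>"
      using run(1)[OF \<eta>] allowed_path_rev[OF run(1)[OF \<eta>']] comm by simp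
    show "run_path (xs @ [0] @ rev xs) \<eta> = exchange 0 1 \<eta>"
      using comm by simp
  qed
qed

text \<open>Take the first length at which there is room. The pattern on a shorter window is the
  restriction of the pattern on a longer one, so failure at all earlier lengths is the second half
  of \<open>stopping\<close>.\<close>

lemma ex_stopping_window:
  fixes \<eta> :: config
  defines "A \<equiv> \<lambda>n. {x\<in>{2..<2 + int n}. \<eta> x}"
  assumes "(r + 1) * card (A N) + r \<le> N"
  shows "\<exists>n\<le>N. stopping r n (A n)"
proof -
  define P where "P = (\<lambda>n. (r + 1) * card (A n) + r \<le> n)"
  define n where "n = (LEAST n. P n)"
  have PN: "P N"
    using assms(2) unfolding P_def .
  have "P n"
    unfolding n_def by (rule LeastI[where P = P, OF PN])
  then have "(r + 1) * card (A n) + r \<le> n"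
    unfolding P_def .
  moreover have "n \<le> N"
    unfolding n_def by (rule Least_le[where P = P, OF PN])
  moreover have "j < (r + 1) * card (A n \<inter> {2..<2 + int j}) + r" if "j < n" for j
  proof -
    have "A n \<inter> {2..<2 + int j} = A j"
      using that by (auto simp: A_def)
    moreover have "\<not> P j"
      using that unfolding n_def by (rule not_less_Least)
    ultimately show ?thesis
      unfolding P_def by simp
  qed
  ultimately show ?thesis
    unfolding stopping_def by blast
qed

text \<open>Room was still missing at length \<open>n - 1\<close>. A stopped pattern therefore
  contains about \<open>n / (r + 1)\<close> particles, which makes it improbable when vacancies
  dominate.\<close>

lemma stopping_card:
  assumes "stopping r n A" "finite A"
  shows "n \<le> (r + 1) * card A + r"
proof (cases n)
  case (Suc m)
  then have "m < (r + 1) * card (A \<inter> {2..<2 + int m}) + r"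
    using assms(1) unfolding stopping_def by auto
  moreover have "card (A \<inter> {2..<2 + int m}) \<le> card A"
    by (rule card_mono) (use assms(2) in auto)
  then have "(r + 1) * card (A \<inter> {2..<2 + int m}) \<le> (r + 1) * card A"
    by (rule mult_le_mono2)
  ultimately show ?thesis
    using Suc by linarith
qed simp

subsection \<open>Estimates along paths\<close>

lemma local_function_vacant_right [intro]: "local_function (\<lambda>\<eta>. of_bool (vacant_right r x \<eta>))"
  unfolding vacant_right_def by (rule local_function_cylinder) simp

lemma local_function_run_path [intro]:
  "local_function f \<Longrightarrow> local_function (\<lambda>\<eta>. f (run_path xs \<eta>))"
proof (induction xs)
  case (Cons x xs)
  then show ?case
    using local_function_exchange[of "\<lambda>\<eta>. f (run_path xs \<eta>)" x "x + 1"] by simp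
qed simp

text \<open>Telescope along the path. Every step starts from an image of \<open>E\<close> under
  exchanges, which has the same mass as \<open>E\<close>, and Cauchy-Schwarz on that event bounds
  its increment by \<open>sqrt J\<close> times the square root of the mass.\<close>

lemma path_estimate:
  assumes \<Phi>: "local_function \<Phi>" and E: "local_function (\<lambda>\<eta>. of_bool (E \<eta>))"
    and "\<And>\<eta>. E \<eta> \<Longrightarrow> allowed_path r xs \<eta>"
    and "\<And>x. x \<in> set xs \<Longrightarrow>
      (\<integral>\<eta>. of_bool (vacant_right r x \<eta>) * (\<Phi> (exchange x (x + 1) \<eta>) - \<Phi> \<eta>)\<^sup>2 \<partial>equilibrium q) \<le> J"
  shows "(\<integral>\<eta>. of_bool (E \<eta>) * \<bar>\<Phi> (run_path xs \<eta>) - \<Phi> \<eta>\<bar> \<partial>equilibrium q) \<le>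
    length xs * (sqrt (\<integral>\<eta>. of_bool (E \<eta>) \<partial>equilibrium q) * sqrt J)"
  using E assms(3-)
proof (induction xs arbitrary: E)
  case Nil
  then show ?case by simp
next
  case (Cons x xs)
  let ?S = "exchange x (x + 1)"
  let ?e = "(\<integral>\<eta>. of_bool (E \<eta>) \<partial>equilibrium q) :: real"
  note loc = Cons.prems(1) \<Phi>
  have E': "local_function (\<lambda>\<eta>. of_bool (E (?S \<eta>)))"
    by (rule local_function_exchange[OF Cons.prems(1)])
  have mass: "(\<integral>\<eta>. of_bool (E (?S \<eta>)) \<partial>equilibrium q) = ?e"
    by (rule integral_equilibrium_exchange[OF Cons.prems(1)])
  \<comment> \<open>Writing \<open>E\<close> at the twice exchanged configuration puts the integrand
    in the form \<open>F (?S \<eta>)\<close>, so that the change of variables applies.\<close>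
  have "(\<integral>\<eta>. of_bool (E \<eta>) * \<bar>\<Phi> (run_path xs (?S \<eta>)) - \<Phi> (?S \<eta>)\<bar> \<partial>equilibrium q) =
      (\<integral>\<eta>. of_bool (E (?S (?S \<eta>))) * \<bar>\<Phi> (run_path xs (?S \<eta>)) - \<Phi> (?S \<eta>)\<bar> \<partial>equilibrium q)"
    by simp
  also have "\<dots> = (\<integral>\<eta>. of_bool (E (?S \<eta>)) * \<bar>\<Phi> (run_path xs \<eta>) - \<Phi> \<eta>\<bar> \<partial>equilibrium q)"
    by (rule integral_equilibrium_exchange[where
          f = "\<lambda>\<eta>. of_bool (E (?S \<eta>)) * \<bar>\<Phi> (run_path xs \<eta>) - \<Phi> \<eta>\<bar>"])
      (intro local_function_mult E' local_function_abs local_function_diff local_function_run_path \<Phi>)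
  also have "\<dots> \<le> length xs * (sqrt (\<integral>\<eta>. of_bool (E (?S \<eta>)) \<partial>equilibrium q) * sqrt J)"
  proof (rule Cons.IH[OF E'])
    show "allowed_path r xs \<eta>" if "E (?S \<eta>)" for \<eta>
      using Cons.prems(2)[OF that] by simp
  qed (use Cons.prems(3) in simp)
  finally have tail: "(\<integral>\<eta>. of_bool (E \<eta>) * \<bar>\<Phi> (run_path xs (?S \<eta>)) - \<Phi> (?S \<eta>)\<bar> \<partial>equilibrium q) \<le>
      length xs * (sqrt ?e * sqrt J)"
    unfolding mass .
  \<comment> \<open>On \<open>E\<close> the first exchange is facilitated, so its indicator may be
    inserted for free.\<close>
  have "(\<integral>\<eta>. of_bool (E \<eta>) * \<bar>\<Phi> (?S \<eta>) - \<Phi> \<eta>\<bar> \<partial>equilibrium q) =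
      (\<integral>\<eta>. \<bar>of_bool (E \<eta>) * (of_bool (vacant_right r x \<eta>) * (\<Phi> (?S \<eta>) - \<Phi> \<eta>))\<bar> \<partial>equilibrium q)"
    using Cons.prems(2) by (intro Bochner_Integration.integral_cong) auto
  also have "\<dots> \<le> sqrt (\<integral>\<eta>. (of_bool (E \<eta>))\<^sup>2 \<partial>equilibrium q) *
      sqrt (\<integral>\<eta>. (of_bool (vacant_right r x \<eta>) * (\<Phi> (?S \<eta>) - \<Phi> \<eta>))\<^sup>2 \<partial>equilibrium q)"
    by (rule integral_Cauchy_Schwarz)
      (intro loc local_function_mult local_function_vacant_right local_function_diff
        local_function_exchange)+
  also have "\<dots> = sqrt ?e * sqrt
      (\<integral>\<eta>. of_bool (vacant_right r x \<eta>) * (\<Phi> (?S \<eta>) - \<Phi> \<eta>)\<^sup>2 \<partial>equilibrium q)"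
    by (simp add: power_mult_distrib power2_eq_square[of "of_bool _"] flip: of_bool_conj)
  also have "\<dots> \<le> sqrt ?e * sqrt J"
    by (intro mult_left_mono real_sqrt_le_mono Cons.prems(3)) simp_all
  finally have head: "(\<integral>\<eta>. of_bool (E \<eta>) * \<bar>\<Phi> (?S \<eta>) - \<Phi> \<eta>\<bar> \<partial>equilibrium q) \<le> sqrt ?e * sqrt J" .
  note L = local_function_exchange[OF local_function_run_path[OF \<Phi>], of xs x "x + 1"]
    local_function_exchange[OF \<Phi>, of x "x + 1"]
  have int: "integrable (equilibrium q) (\<lambda>\<eta>. of_bool (E \<eta>) * \<bar>\<Phi> (run_path xs (?S \<eta>)) - \<Phi> (?S \<eta>)\<bar>)"
      "integrable (equilibrium q) (\<lambda>\<eta>. of_bool (E \<eta>) * \<bar>\<Phi> (?S \<eta>) - \<Phi> \<eta>\<bar>)"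
      "integrable (equilibrium q) (\<lambda>\<eta>. of_bool (E \<eta>) * \<bar>\<Phi> (run_path xs (?S \<eta>)) - \<Phi> \<eta>\<bar>)"
    by (intro local_function_integrable local_function_mult local_function_abs local_function_diff
        L loc)+
  have "(\<integral>\<eta>. of_bool (E \<eta>) * \<bar>\<Phi> (run_path (x # xs) \<eta>) - \<Phi> \<eta>\<bar> \<partial>equilibrium q) \<le>
      (\<integral>\<eta>. of_bool (E \<eta>) * \<bar>\<Phi> (run_path xs (?S \<eta>)) - \<Phi> (?S \<eta>)\<bar> +
        of_bool (E \<eta>) * \<bar>\<Phi> (?S \<eta>) - \<Phi> \<eta>\<bar> \<partial>equilibrium q)"
    using int by (intro integral_mono Bochner_Integration.integrable_add) auto
  also have "\<dots> \<le> length xs * (sqrt ?e * sqrt J) + sqrt ?e * sqrt J"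
    using tail head int by (subst Bochner_Integration.integral_add) auto
  also have "\<dots> = length (x # xs) * (sqrt ?e * sqrt J)"
    by (simp add: algebra_simps)
  finally show ?case .
qed

section \<open>Summation over stopping patterns\<close>

lemma two_square_le_power: "2 * real n ^ 2 + 1 \<le> 4 * 2 ^ n"
proof (induction n)
  case (Suc n)
  have "real n + 1 \<le> 2 ^ n"
    using less_exp[of n] by (metis Suc_leI of_nat_Suc of_nat_le_numeral_power_cancel_iff add.commute)
  then show ?case
    using Suc by (simp add: power2_eq_square algebra_simps)
qed simp

lemma sum_half_power_le: "(\<Sum>n\<le>N. (1 / 2 :: real) ^ n) \<le> 2"
  by (simp add: sum_gp0)

text \<open>At least \<open>(n - r) / (r + 1)\<close> particles, each of probability at most
  \<open>(1 / 8) ^ (2 * (r + 1))\<close>. The bound is written as a square because path estimates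
  use its root, which must beat the \<open>2 ^ n\<close> patterns times a path length of order
  \<open>2 ^ n\<close>; base 8 leaves a factor 1/2 per site.\<close>

lemma integral_window_le:
  assumes q: "0 < q" "q < 1" "1 - q \<le> (1 / 8) ^ (2 * (r + 1))"
    and A: "A \<subseteq> {2..<2 + int n}" "n \<le> (r + 1) * card A + r"
  shows "(\<integral>\<eta>. of_bool (\<forall>x\<in>{2..<2 + int n}. \<eta> x \<longleftrightarrow> x \<in> A) \<partial>equilibrium q) \<le>
    (8 ^ r / 8 ^ n :: real)\<^sup>2"
proof -
  have "(\<integral>\<eta>. of_bool (\<forall>x\<in>{2..<2 + int n}. \<eta> x \<longleftrightarrow> x \<in> A) \<partial>equilibrium q) \<le> (1 - q) ^ card A"
    using q A by (intro integral_cylinder_le) auto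
  also have "\<dots> \<le> ((1 / 8) ^ (2 * (r + 1))) ^ card A"
    using q by (intro power_mono) auto
  also have "\<dots> = ((1 / 8) ^ ((r + 1) * card A))\<^sup>2"
    by (simp only: power_mult[symmetric] ac_simps)
  also have "\<dots> \<le> (8 ^ r / 8 ^ n)\<^sup>2"
  proof (rule power_mono)
    have "(1 / 8 :: real) ^ ((r + 1) * card A) = 8 ^ r * (1 / 8) ^ ((r + 1) * card A + r)"
      by (simp add: power_add power_one_over)
    also have "\<dots> \<le> 8 ^ r * (1 / 8) ^ n"
      using A(2) by (intro mult_left_mono power_decreasing) auto
    finally show "(1 / 8 :: real) ^ ((r + 1) * card A) \<le> 8 ^ r / 8 ^ n"
      by (simp add: power_one_over)
  qed simp
  finally show ?thesis .
qed

text \<open>Configurations are split according to the pattern at which they first stop, up to a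
  cutoff \<open>N\<close>, with crowded windows of length \<open>N\<close> as remainder. The
  function \<open>g\<close> is left abstract so that both the current and its mirror image fit. The
  potential may depend on \<open>n\<close>, since the formal one is an infinite sum and only
  truncations are local.\<close>

lemma gradient_estimate:
  assumes q: "0 < q" "q < 1" "1 - q \<le> (1 / 8) ^ (2 * (r + 1))"
    and g: "local_function g" and "0 \<le> J"
    and potential: "\<And>n. \<exists>\<Phi>. local_function \<Phi> \<and> (\<forall>\<eta>. \<Phi> (exchange 0 1 \<eta>) - \<Phi> \<eta> = g \<eta>) \<and>
      (\<forall>x\<in>{0..<2 + int n}. (\<integral>\<eta>. of_bool (vacant_right r x \<eta>) *
         (\<Phi> (exchange x (x + 1) \<eta>) - \<Phi> \<eta>)\<^sup>2 \<partial>equilibrium q) \<le> J)"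
  shows "(\<integral>\<eta>. \<bar>g \<eta>\<bar> \<partial>equilibrium q) \<le> 8 * 8 ^ r * sqrt J"
proof -
  define W where "W n A \<eta> \<longleftrightarrow> (\<forall>x\<in>{2..<2 + int n}. \<eta> x \<longleftrightarrow> x \<in> A)" for n A and \<eta> :: config
  define S where "S n = {A\<in>Pow {2..<2 + int n}. stopping r n A}" for n
  define T where "T n = {A\<in>Pow {2..<2 + int n}. n < (r + 1) * card A + r}" for n
  have card_le: "card {A\<in>Pow {2..<2 + int n}. P A} \<le> 2 ^ n" for n P
  proof -
    have "card {A\<in>Pow {2..<2 + int n}. P A} \<le> card (Pow {2..<2 + int n})"
      by (rule card_mono) auto
    then show ?thesis
      by (simp add: card_Pow)
  qed
  have fin: "finite (S n)" "finite (T n)" for n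
    unfolding S_def T_def by auto
  have W_local: "local_function (\<lambda>\<eta>. of_bool (W n A \<eta>))" for n A
    unfolding W_def by (rule local_function_cylinder) simp
  have Wg_int: "integrable (equilibrium q) (\<lambda>\<eta>. of_bool (W n A \<eta>) * \<bar>g \<eta>\<bar>)" for n A
    by (intro local_function_integrable local_function_mult local_function_abs W_local g)
  obtain B where B: "0 \<le> B" "\<And>\<eta>. \<bar>g \<eta>\<bar> \<le> B"
    using local_function_bounded[OF g] by blast
  have stop_bound: "(\<integral>\<eta>. of_bool (W n A \<eta>) * \<bar>g \<eta>\<bar> \<partial>equilibrium q) \<le>
      4 * 2 ^ n * (8 ^ r / 8 ^ n * sqrt J)" if "A \<in> S n" for n A
  proof -
    have A: "A \<subseteq> {2..<2 + int n}" "stopping r n A"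
      using that by (auto simp: S_def)
    obtain xs where xs: "length xs \<le> 2 * n\<^sup>2 + 1" "set xs \<subseteq> {0..<2 + int n}"
      and run: "\<forall>\<eta>. (\<forall>x\<in>{2..<2 + int n}. \<eta> x \<longleftrightarrow> x \<in> A) \<longrightarrow>
        allowed_path r xs \<eta> \<and> run_path xs \<eta> = exchange 0 1 \<eta>"
      using exchange_path[OF A] by (elim exE conjE)
    obtain \<Phi> where \<Phi>: "local_function \<Phi>" "\<forall>\<eta>. \<Phi> (exchange 0 1 \<eta>) - \<Phi> \<eta> = g \<eta>"
      "\<forall>x\<in>{0..<2 + int n}. (\<integral>\<eta>. of_bool (vacant_right r x \<eta>) *
         (\<Phi> (exchange x (x + 1) \<eta>) - \<Phi> \<eta>)\<^sup>2 \<partial>equilibrium q) \<le> J"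
      using potential[of n] by (elim exE conjE)
    \<comment> \<open>On this pattern the path realises the exchange of 0 and 1, so \<open>g\<close>
      is the total increment of \<open>\<Phi>\<close> along it.\<close>
    have "of_bool (W n A \<eta>) * \<bar>g \<eta>\<bar> = of_bool (W n A \<eta>) * \<bar>\<Phi> (run_path xs \<eta>) - \<Phi> \<eta>\<bar>" for \<eta>
    proof (cases "W n A \<eta>")
      case True
      then have "run_path xs \<eta> = exchange 0 1 \<eta>"
        using run unfolding W_def by blast
      then show ?thesis
        using \<Phi>(2)[THEN spec, of \<eta>] by (simp only:)
    qed simp
    then have "(\<integral>\<eta>. of_bool (W n A \<eta>) * \<bar>g \<eta>\<bar> \<partial>equilibrium q) =
        (\<integral>\<eta>. of_bool (W n A \<eta>) * \<bar>\<Phi> (run_path xs \<eta>) - \<Phi> \<eta>\<bar> \<partial>equilibrium q)"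
      by (simp only:)
    also have "\<dots> \<le> length xs * (sqrt (\<integral>\<eta>. of_bool (W n A \<eta>) \<partial>equilibrium q) * sqrt J)"
    proof (rule path_estimate[OF \<Phi>(1) W_local])
      show "allowed_path r xs \<eta>" if "W n A \<eta>" for \<eta>
        using run that unfolding W_def by blast
      show "(\<integral>\<eta>. of_bool (vacant_right r x \<eta>) *
         (\<Phi> (exchange x (x + 1) \<eta>) - \<Phi> \<eta>)\<^sup>2 \<partial>equilibrium q) \<le> J" if "x \<in> set xs" for x
        using \<Phi>(3) xs(2) that by blast
    qed
    also have "\<dots> \<le> 4 * 2 ^ n * (8 ^ r / 8 ^ n * sqrt J)"
    proof (intro mult_mono)
      have "real (length xs) \<le> real (2 * n\<^sup>2 + 1)"
        using xs(1) by (rule of_nat_mono)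
      then show "real (length xs) \<le> 4 * 2 ^ n"
        using two_square_le_power[of n] by simp
      have "finite A"
        using A(1) by (rule finite_subset) simp
      then have "(\<integral>\<eta>. of_bool (W n A \<eta>) \<partial>equilibrium q) \<le> (8 ^ r / 8 ^ n :: real)\<^sup>2"
        unfolding W_def using q A by (intro integral_window_le stopping_card) auto
      then show "sqrt (\<integral>\<eta>. of_bool (W n A \<eta>) \<partial>equilibrium q) \<le> 8 ^ r / 8 ^ n"
        by (rule real_le_lsqrt[rotated]) simp
    qed (use \<open>0 \<le> J\<close> in simp_all)
    finally show ?thesis .
  qed
  have bad_bound: "(\<integral>\<eta>. of_bool (W n A \<eta>) * \<bar>g \<eta>\<bar> \<partial>equilibrium q) \<le> B * (8 ^ r / 8 ^ n)\<^sup>2"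
    if "A \<in> T n" for n A
  proof -
    have "(\<integral>\<eta>. of_bool (W n A \<eta>) * \<bar>g \<eta>\<bar> \<partial>equilibrium q) \<le>
        (\<integral>\<eta>. B * of_bool (W n A \<eta>) \<partial>equilibrium q)"
      using B Wg_int by (intro integral_mono) (auto intro!: local_function_integrable W_local)
    also have "\<dots> = B * (\<integral>\<eta>. of_bool (W n A \<eta>) \<partial>equilibrium q)"
      by simp
    also have "\<dots> \<le> B * (8 ^ r / 8 ^ n)\<^sup>2"
      unfolding W_def using q that B(1)
      by (intro mult_left_mono integral_window_le) (auto simp: T_def)
    finally show ?thesis .
  qed
  have "(\<integral>\<eta>. \<bar>g \<eta>\<bar> \<partial>equilibrium q) \<le> 8 * 8 ^ r * sqrt J + B * (8 ^ r)\<^sup>2 * (1 / 32) ^ N" for N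
  proof -
    have pointwise: "\<bar>g \<eta>\<bar> \<le> (\<Sum>n\<le>N. \<Sum>A\<in>S n. of_bool (W n A \<eta>) * \<bar>g \<eta>\<bar>) +
        (\<Sum>A\<in>T N. of_bool (W N A \<eta>) * \<bar>g \<eta>\<bar>)" for \<eta>
    proof -
      define A where "A n = {x\<in>{2..<2 + int n}. \<eta> x}" for n
      have WA: "W n (A n) \<eta>" for n
        by (auto simp: W_def A_def)
      show ?thesis
      proof (cases "(r + 1) * card (A N) + r \<le> N")
        case True
        then obtain n where n: "n \<le> N" "stopping r n (A n)"
          using ex_stopping_window[of r N \<eta>] unfolding A_def by blast
        then have "A n \<in> S n"
          by (auto simp: S_def A_def)
        then have "of_bool (W n (A n) \<eta>) * \<bar>g \<eta>\<bar> \<le> (\<Sum>A\<in>S n. of_bool (W n A \<eta>) * \<bar>g \<eta>\<bar>)"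
          using fin by (intro member_le_sum) auto
        also have "\<dots> \<le> (\<Sum>n\<le>N. \<Sum>A\<in>S n. of_bool (W n A \<eta>) * \<bar>g \<eta>\<bar>)"
          using n(1) by (intro member_le_sum) (auto intro!: sum_nonneg)
        finally show ?thesis
          using WA by (simp add: add_increasing2 sum_nonneg)
      next
        case False
        then have "A N \<in> T N"
          by (auto simp: T_def A_def)
        then have "of_bool (W N (A N) \<eta>) * \<bar>g \<eta>\<bar> \<le> (\<Sum>A\<in>T N. of_bool (W N A \<eta>) * \<bar>g \<eta>\<bar>)"
          using fin by (intro member_le_sum) auto
        then show ?thesis
          using WA by (simp add: add_increasing sum_nonneg)
      qed
    qed
    have "(\<integral>\<eta>. \<bar>g \<eta>\<bar> \<partial>equilibrium q) \<le>
        (\<integral>\<eta>. (\<Sum>n\<le>N. \<Sum>A\<in>S n. of_bool (W n A \<eta>) * \<bar>g \<eta>\<bar>) +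
          (\<Sum>A\<in>T N. of_bool (W N A \<eta>) * \<bar>g \<eta>\<bar>) \<partial>equilibrium q)"
      by (intro integral_mono pointwise Bochner_Integration.integrable_add
          Bochner_Integration.integrable_sum Wg_int local_function_integrable local_function_abs g)
    also have "\<dots> = (\<Sum>n\<le>N. \<Sum>A\<in>S n. \<integral>\<eta>. of_bool (W n A \<eta>) * \<bar>g \<eta>\<bar> \<partial>equilibrium q) +
          (\<Sum>A\<in>T N. \<integral>\<eta>. of_bool (W N A \<eta>) * \<bar>g \<eta>\<bar> \<partial>equilibrium q)"
      using Wg_int by (simp add: Bochner_Integration.integral_add Bochner_Integration.integral_sum)
    also have "\<dots> \<le> (\<Sum>n\<le>N. 4 * 8 ^ r * sqrt J * (1 / 2) ^ n) + B * (8 ^ r)\<^sup>2 * (1 / 32) ^ N"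
    proof (intro add_mono sum_mono)
      fix n
      have "(\<Sum>A\<in>S n. \<integral>\<eta>. of_bool (W n A \<eta>) * \<bar>g \<eta>\<bar> \<partial>equilibrium q) \<le>
          real (card (S n)) * (4 * 2 ^ n * (8 ^ r / 8 ^ n * sqrt J))"
        by (rule sum_bounded_above) (rule stop_bound)
      \<comment> \<open>The sum over stopping patterns is bounded through the number of all subsets
        of the window.\<close>
      also have "\<dots> \<le> 2 ^ n * (4 * 2 ^ n * (8 ^ r / 8 ^ n * sqrt J))"
        using card_le[of n "stopping r n"] \<open>0 \<le> J\<close>
        by (intro mult_right_mono) (simp_all add: S_def)
      also have "\<dots> = 4 * 8 ^ r * sqrt J * (2 ^ n * 2 ^ n / 8 ^ n)"
        by simp
      also have "(2 ^ n * 2 ^ n / 8 ^ n :: real) = (1 / 2) ^ n"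
        by (simp flip: power_mult_distrib power_divide)
      finally show "(\<Sum>A\<in>S n. \<integral>\<eta>. of_bool (W n A \<eta>) * \<bar>g \<eta>\<bar> \<partial>equilibrium q) \<le>
          4 * 8 ^ r * sqrt J * (1 / 2) ^ n" .
    next
      have "(\<Sum>A\<in>T N. \<integral>\<eta>. of_bool (W N A \<eta>) * \<bar>g \<eta>\<bar> \<partial>equilibrium q) \<le>
          real (card (T N)) * (B * (8 ^ r / 8 ^ N)\<^sup>2)"
        by (rule sum_bounded_above) (rule bad_bound)
      also have "\<dots> \<le> 2 ^ N * (B * (8 ^ r / 8 ^ N)\<^sup>2)"
        using card_le[of N "\<lambda>A. N < (r + 1) * card A + r"] B(1)
        by (intro mult_right_mono) (simp_all add: T_def)
      also have "\<dots> = B * (8 ^ r)\<^sup>2 * (2 ^ N / (8 ^ N * 8 ^ N))"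
        by (simp add: power2_eq_square)
      also have "(2 ^ N / (8 ^ N * 8 ^ N) :: real) = (1 / 32) ^ N"
        by (simp flip: power_mult_distrib power_divide)
      finally show "(\<Sum>A\<in>T N. \<integral>\<eta>. of_bool (W N A \<eta>) * \<bar>g \<eta>\<bar> \<partial>equilibrium q) \<le>
          B * (8 ^ r)\<^sup>2 * (1 / 32) ^ N" .
    qed
    also have "(\<Sum>n\<le>N. 4 * 8 ^ r * sqrt J * (1 / 2) ^ n) \<le> 8 * 8 ^ r * sqrt J"
      using mult_left_mono[OF sum_half_power_le[of N], of "4 * 8 ^ r * sqrt J"] \<open>0 \<le> J\<close>
      by (simp add: sum_distrib_left)
    finally show ?thesis
      by simp
  qed
  \<comment> \<open>The bound \<open>B\<close> depends on \<open>g\<close>, so it must not survive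
    in a uniform estimate; letting \<open>N\<close> grow removes it.\<close>
  moreover have "(\<lambda>N. 8 * 8 ^ r * sqrt J + B * (8 ^ r)\<^sup>2 * (1 / 32) ^ N)
      \<longlonglongrightarrow> 8 * 8 ^ r * sqrt J + B * (8 ^ r)\<^sup>2 * 0"
    by (intro tendsto_intros LIMSEQ_realpow_zero) auto
  ultimately show ?thesis
    by (intro LIMSEQ_le_const[where X = "\<lambda>N. 8 * 8 ^ r * sqrt J + B * (8 ^ r)\<^sup>2 * (1 / 32) ^ N"]) auto
qed

subsection \<open>The current\<close>

text \<open>At \<open>x = 0\<close> this is the expression squared in the Green-Kubo functional. The
  other bonds are needed because paths leave the bond of 0 and 1.\<close>

definition current :: "(config \<Rightarrow> real) \<Rightarrow> int \<Rightarrow> config \<Rightarrow> real" where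
  "current f x \<eta> = of_bool (\<eta> x) - of_bool (\<eta> (x + 1)) +
     (\<Sum>\<^sub>\<infinity>z::int. f (shift z (exchange x (x + 1) \<eta>)) - f (shift z \<eta>))"

lemma shift_shift: "shift z (shift w \<eta>) = shift (z + w) \<eta>"
  by (simp add: shift_def algebra_simps)

lemma shift_exchange:
  "shift z (exchange x y \<eta>) = exchange (x + z) (y + z) (shift z \<eta>)"
  by (auto simp: shift_def exchange_def fun_eq_iff)

lemma current_shift: "current f x \<eta> = current f 0 (shift (- x) \<eta>)"
proof -
  let ?h = "\<lambda>z. f (shift z (exchange x (x + 1) \<eta>)) - f (shift z \<eta>)"
  have "(\<Sum>\<^sub>\<infinity>z. f (shift z (exchange 0 1 (shift (- x) \<eta>))) - f (shift z (shift (- x) \<eta>))) =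
      (\<Sum>\<^sub>\<infinity>z. ?h (z - x))"
  proof -
    have "exchange 0 1 (shift (- x) \<eta>) = shift (- x) (exchange x (x + 1) \<eta>)"
      by (simp add: shift_exchange)
    then show ?thesis
      by (simp only: shift_shift) simp
  qed
  also have "\<dots> = (\<Sum>\<^sub>\<infinity>z. ?h z)"
    by (rule infsum_reindex_bij_betw) (auto intro!: bij_betw_byWitness[where f' = "\<lambda>z. z + x"])
  moreover have "shift (- x) \<eta> 0 = \<eta> x" "shift (- x) \<eta> 1 = \<eta> (x + 1)"
    by (simp_all add: shift_def add.commute)
  ultimately show ?thesis
    by (simp add: current_def)
qed

lemma local_function_window:
  assumes "local_function f"
  obtains M where "0 \<le> M" "\<forall>\<eta> \<omega>. (\<forall>u\<in>{- M..M}. \<eta> u = \<omega> u) \<longrightarrow> f \<eta> = f \<omega>"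
proof -
  obtain A where A: "finite A" "\<forall>\<eta> \<omega>. (\<forall>x\<in>A. \<eta> x = \<omega> x) \<longrightarrow> f \<eta> = f \<omega>"
    using assms unfolding local_function_def by (elim exE conjE)
  define M where "M = Max (insert 0 (abs ` A))"
  have M: "0 \<le> M" "u \<in> A \<Longrightarrow> \<bar>u\<bar> \<le> M" for u
    using A(1) by (auto simp: M_def)
  show thesis
  proof (rule that[OF M(1)], intro allI impI)
    fix \<eta> \<omega> :: config assume "\<forall>u\<in>{- M..M}. \<eta> u = \<omega> u"
    then have "\<forall>x\<in>A. \<eta> x = \<omega> x"
      using M(2) by (metis abs_le_iff atLeastAtMost_iff minus_le_iff)
    then show "f \<eta> = f \<omega>"
      by (rule A(2)[THEN spec, THEN spec, THEN mp])
  qed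
qed

text \<open>For \<open>z\<close> outside the range, the translate by \<open>z\<close> carries both
  sites of the bond out of the window that \<open>f\<close> sees, and the term vanishes.\<close>

lemma current_finite_sum:
  assumes f: "\<forall>\<eta> \<omega>. (\<forall>u\<in>{- M..M}. \<eta> u = \<omega> u) \<longrightarrow> f \<eta> = f \<omega>"
    and L: "M + \<bar>x\<bar> < L"
  shows "current f x \<eta> = of_bool (\<eta> x) - of_bool (\<eta> (x + 1)) +
     (\<Sum>z\<in>{- L..L}. f (shift z (exchange x (x + 1) \<eta>)) - f (shift z \<eta>))"
proof -
  have "f (shift z (exchange x (x + 1) \<eta>)) - f (shift z \<eta>) = 0" if "z \<notin> {- L..L}" for z
  proof -
    have "\<forall>u\<in>{- M..M}. shift z (exchange x (x + 1) \<eta>) u = shift z \<eta> u"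
      using that L by (auto simp: shift_def exchange_def)
    then have "f (shift z (exchange x (x + 1) \<eta>)) = f (shift z \<eta>)"
      by (rule f[THEN spec, THEN spec, THEN mp])
    then show ?thesis by simp
  qed
  then have "(\<Sum>\<^sub>\<infinity>z. f (shift z (exchange x (x + 1) \<eta>)) - f (shift z \<eta>)) =
      (\<Sum>\<^sub>\<infinity>z\<in>{- L..L}. f (shift z (exchange x (x + 1) \<eta>)) - f (shift z \<eta>))"
    by (intro infsum_cong_neutral) auto
  then show ?thesis
    by (simp add: current_def)
qed

text \<open>Only the weights \<open>x\<close> and \<open>x + 1\<close> are affected, and they differ
  by 1: a particle hopping to the right raises the first moment by 1.\<close>

lemma first_moment_exchange:
  assumes "{x, x + 1} \<subseteq> {- L..L}"
  shows "(\<Sum>y\<in>{- L..L}. real_of_int y * of_bool (exchange x (x + 1) \<eta> y)) -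
      (\<Sum>y\<in>{- L..L}. real_of_int y * of_bool (\<eta> y)) = of_bool (\<eta> x) - of_bool (\<eta> (x + 1))"
proof -
  have "(\<Sum>y\<in>{- L..L}. real_of_int y * of_bool (exchange x (x + 1) \<eta> y)) -
      (\<Sum>y\<in>{- L..L}. real_of_int y * of_bool (\<eta> y)) =
      (\<Sum>y\<in>{- L..L}. real_of_int y * of_bool (exchange x (x + 1) \<eta> y) - real_of_int y * of_bool (\<eta> y))"
    by (rule sum_subtractf[symmetric])
  also have "\<dots> = (\<Sum>y\<in>{x, x + 1}. real_of_int y * of_bool (exchange x (x + 1) \<eta> y) - real_of_int y * of_bool (\<eta> y))"
    using assms by (intro sum.mono_neutral_right) (auto simp: exchange_def)
  also have "\<dots> = of_bool (\<eta> x) - of_bool (\<eta> (x + 1))"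
    by (simp add: exchange_def algebra_simps)
  finally show ?thesis .
qed

text \<open>The current is the gradient of the formal potential
  \<open>\<Sum>y. y * \<eta> y + \<Sum>z. f (shift z \<eta>)\<close>; on bonds in a bounded region a truncation suffices.\<close>

lemma current_potential:
  assumes "local_function f"
  obtains \<Phi> where "local_function \<Phi>"
    "\<And>x \<eta>. \<bar>x\<bar> \<le> n \<Longrightarrow> \<Phi> (exchange x (x + 1) \<eta>) - \<Phi> \<eta> = current f x \<eta>"
proof -
  obtain M where M: "0 \<le> M" "\<forall>\<eta> \<omega>. (\<forall>u\<in>{- M..M}. \<eta> u = \<omega> u) \<longrightarrow> f \<eta> = f \<omega>"
    using assms by (rule local_function_window)
  \<comment> \<open>Large enough for \<open>M + \<bar>x\<bar> < L\<close> and for both ends of every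
    bond with \<open>\<bar>x\<bar> \<le> n\<close> to lie in \<open>{- L..L}\<close>.\<close>
  define L where "L = M + n + 1"
  define \<Phi> where "\<Phi> \<eta> = (\<Sum>y\<in>{- L..L}. real_of_int y * of_bool (\<eta> y)) + (\<Sum>z\<in>{- L..L}. f (shift z \<eta>))"
    for \<eta>
  show thesis
  proof (rule that)
    show "local_function \<Phi>"
      unfolding \<Phi>_def
      by (intro local_function_add local_function_sum local_function_mult local_function_const
          local_function_site local_function_shift assms)
    fix x \<eta> assume x: "\<bar>x\<bar> \<le> n"
    have "\<Phi> (exchange x (x + 1) \<eta>) - \<Phi> \<eta> =
        ((\<Sum>y\<in>{- L..L}. real_of_int y * of_bool (exchange x (x + 1) \<eta> y)) -
          (\<Sum>y\<in>{- L..L}. real_of_int y * of_bool (\<eta> y))) +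
        (\<Sum>z\<in>{- L..L}. f (shift z (exchange x (x + 1) \<eta>)) - f (shift z \<eta>))"
      by (simp add: \<Phi>_def sum_subtractf)
    also have "(\<Sum>y\<in>{- L..L}. real_of_int y * of_bool (exchange x (x + 1) \<eta> y)) -
          (\<Sum>y\<in>{- L..L}. real_of_int y * of_bool (\<eta> y)) = of_bool (\<eta> x) - of_bool (\<eta> (x + 1))"
      using x M(1) by (intro first_moment_exchange) (auto simp: L_def)
    also have "of_bool (\<eta> x) - of_bool (\<eta> (x + 1)) +
        (\<Sum>z\<in>{- L..L}. f (shift z (exchange x (x + 1) \<eta>)) - f (shift z \<eta>)) = current f x \<eta>"
      by (rule current_finite_sum[OF M(2), symmetric]) (use x in \<open>simp add: L_def\<close>)
    finally show "\<Phi> (exchange x (x + 1) \<eta>) - \<Phi> \<eta> = current f x \<eta>" .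
  qed
qed

text \<open>Locality is not visible through the infinite sum; it is inherited from a truncated
  potential of which the current is the gradient.\<close>

lemma local_function_current:
  assumes "local_function f"
  shows "local_function (current f x)"
proof -
  obtain \<Phi> where \<Phi>: "local_function \<Phi>"
    "\<And>y \<eta>. \<bar>y\<bar> \<le> \<bar>x\<bar> \<Longrightarrow> \<Phi> (exchange y (y + 1) \<eta>) - \<Phi> \<eta> = current f y \<eta>"
    using current_potential[OF assms, of "\<bar>x\<bar>"] by blast
  have "current f x = (\<lambda>\<eta>. \<Phi> (exchange x (x + 1) \<eta>) - \<Phi> \<eta>)"
    by (rule ext) (rule \<Phi>(2)[symmetric], simp)
  then show ?thesis
    using local_function_diff[OF local_function_exchange[OF \<Phi>(1)] \<Phi>(1), of x "x + 1"] by (simp only:)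
qed

text \<open>The microscopic current is orthogonal to all gradients of local functions, because it is itself
  a discrete derivative of the occupation number.\<close>

lemma integral_current:
  assumes "local_function f"
  shows "(\<integral>\<eta>. (of_bool (\<eta> 0) - of_bool (\<eta> 1)) * current f 0 \<eta> \<partial>equilibrium q) =
    (\<integral>\<eta>. (of_bool (\<eta> 0) - of_bool (\<eta> 1))\<^sup>2 \<partial>equilibrium q)"
proof -
  obtain M where M: "0 \<le> M" "\<forall>\<eta> \<omega>. (\<forall>u\<in>{- M..M}. \<eta> u = \<omega> u) \<longrightarrow> f \<eta> = f \<omega>"
    using assms by (rule local_function_window)
  define L where "L = M + 1"
  define j :: "config \<Rightarrow> real" where "j \<eta> = of_bool (\<eta> 0) - of_bool (\<eta> 1)" for \<eta>
  define a where "a z = (\<integral>\<eta>. of_bool (\<eta> z) * f \<eta> \<partial>equilibrium q)" for z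
  let ?d = "\<lambda>z \<eta>. f (shift z (exchange 0 1 \<eta>)) - f (shift z \<eta>)"
  have j: "local_function j"
    unfolding j_def by (intro local_function_diff local_function_site)
  have fs: "local_function (\<lambda>\<eta>. f (shift z \<eta>))" for z
    by (rule local_function_shift[OF assms])
  have fse: "local_function (\<lambda>\<eta>. f (shift z (exchange 0 1 \<eta>)))" for z
    by (rule local_function_exchange[OF fs])
  note loc = j fs fse
  \<comment> \<open>After translation the correlation with \<open>j\<close> becomes a discrete
    derivative in \<open>z\<close> of the correlation \<open>a\<close> between occupation and
    \<open>f\<close>.\<close>
  have shifted: "(\<integral>\<eta>. j \<eta> * f (shift z \<eta>) \<partial>equilibrium q) = a z - a (z + 1)" for z
  proof -
    let ?g = "\<lambda>\<eta>. of_bool (\<eta> z) * f \<eta> - of_bool (\<eta> (z + 1)) * f \<eta>"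
    have loc': "local_function (\<lambda>\<eta>. of_bool (\<eta> z) * f \<eta>)" for z
      by (intro local_function_mult local_function_site assms)
    have "(\<integral>\<eta>. j \<eta> * f (shift z \<eta>) \<partial>equilibrium q) = (\<integral>\<eta>. ?g (shift z \<eta>) \<partial>equilibrium q)"
      by (simp add: j_def shift_def algebra_simps)
    also have "\<dots> = (\<integral>\<eta>. ?g \<eta> \<partial>equilibrium q)"
      by (rule integral_equilibrium_shift) (intro local_function_diff loc')
    also have "\<dots> = a z - a (z + 1)"
      unfolding a_def by (intro Bochner_Integration.integral_diff local_function_integrable loc')
    finally show ?thesis .
  qed
  \<comment> \<open>The exchange preserves the measure and reverses the sign of \<open>j\<close>, so
    the two parts of each gradient term reinforce each other.\<close>
  have exchanged: "(\<integral>\<eta>. j \<eta> * f (shift z (exchange 0 1 \<eta>)) \<partial>equilibrium q) =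
      - (\<integral>\<eta>. j \<eta> * f (shift z \<eta>) \<partial>equilibrium q)" for z
  proof -
    have "j (exchange 0 1 \<eta>) = - j \<eta>" for \<eta>
      by (simp add: j_def exchange_def)
    then have "(\<integral>\<eta>. j \<eta> * f (shift z (exchange 0 1 \<eta>)) \<partial>equilibrium q) =
        (\<integral>\<eta>. - (j (exchange 0 1 \<eta>) * f (shift z (exchange 0 1 \<eta>))) \<partial>equilibrium q)"
      by simp
    also have "\<dots> = (\<integral>\<eta>. - (j \<eta> * f (shift z \<eta>)) \<partial>equilibrium q)"
      by (rule integral_equilibrium_exchange[where f = "\<lambda>\<eta>. - (j \<eta> * f (shift z \<eta>))"])
        (intro local_function_apply[where h = uminus] local_function_mult loc)
    finally show ?thesis
      by simp
  qed
  have paired: "(\<integral>\<eta>. j \<eta> * ?d z \<eta> \<partial>equilibrium q) = - 2 * (a z - a (z + 1))" for z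
  proof -
    have "(\<integral>\<eta>. j \<eta> * ?d z \<eta> \<partial>equilibrium q) =
        (\<integral>\<eta>. j \<eta> * f (shift z (exchange 0 1 \<eta>)) \<partial>equilibrium q) -
        (\<integral>\<eta>. j \<eta> * f (shift z \<eta>) \<partial>equilibrium q)"
      unfolding right_diff_distrib
      by (intro Bochner_Integration.integral_diff local_function_integrable local_function_mult loc)
    then show ?thesis
      unfolding exchanged shifted by simp
  qed
  \<comment> \<open>\<open>f\<close> sees neither \<open>- L\<close> nor \<open>L + 1\<close>, so
    these sites can be exchanged; the two end terms of the telescoping sum then cancel.\<close>
  have boundary: "a (- L) = a (L + 1)"
  proof -
    have "f (exchange (- L) (L + 1) \<eta>) = f \<eta>" for \<eta>
      by (rule M(2)[THEN spec, THEN spec, THEN mp]) (auto simp: exchange_def L_def)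
    then have "a (- L) = (\<integral>\<eta>. of_bool (exchange (- L) (L + 1) \<eta> (L + 1)) * f (exchange (- L) (L + 1) \<eta>) \<partial>equilibrium q)"
      by (simp add: a_def exchange_def)
    also have "\<dots> = a (L + 1)"
      unfolding a_def by (rule integral_equilibrium_exchange[where f = "\<lambda>\<eta>. of_bool (\<eta> (L + 1)) * f \<eta>"])
        (intro local_function_mult local_function_site assms)
    finally show ?thesis .
  qed
  have telescope: "(\<Sum>z\<in>{- L..L}. a z - a (z + 1)) = 0"
  proof -
    have "(\<Sum>z\<in>{- L..L}. a (z + 1)) = (\<Sum>z\<in>{- L + 1..L + 1}. a z)"
      by (rule sum.reindex_bij_witness[of _ "\<lambda>z. z - 1" "\<lambda>z. z + 1"]) auto
    also have "{- L + 1..L + 1} = insert (L + 1) {- L + 1..L}"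
      using M(1) by (auto simp: L_def)
    also have "(\<Sum>z\<in>\<dots>. a z) = (\<Sum>z\<in>insert (- L) {- L + 1..L}. a z)"
      using boundary by simp
    also have "insert (- L) {- L + 1..L} = {- L..L}"
      using M(1) by (auto simp: L_def)
    finally show ?thesis
      by (simp add: sum_subtractf)
  qed
  have "(\<integral>\<eta>. j \<eta> * current f 0 \<eta> \<partial>equilibrium q) =
      (\<integral>\<eta>. (j \<eta>)\<^sup>2 + (\<Sum>z\<in>{- L..L}. j \<eta> * ?d z \<eta>) \<partial>equilibrium q)"
    using current_finite_sum[OF M(2), of 0 L]
    by (simp add: L_def j_def power2_eq_square distrib_left sum_distrib_left)
  also have "\<dots> = (\<integral>\<eta>. (j \<eta>)\<^sup>2 \<partial>equilibrium q) +
      (\<integral>\<eta>. (\<Sum>z\<in>{- L..L}. j \<eta> * ?d z \<eta>) \<partial>equilibrium q)"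
    by (intro Bochner_Integration.integral_add local_function_integrable local_function_sum
        local_function_power local_function_mult local_function_diff loc)
  also have "(\<integral>\<eta>. (\<Sum>z\<in>{- L..L}. j \<eta> * ?d z \<eta>) \<partial>equilibrium q) =
      (\<Sum>z\<in>{- L..L}. \<integral>\<eta>. j \<eta> * ?d z \<eta> \<partial>equilibrium q)"
    by (intro Bochner_Integration.integral_sum local_function_integrable
        local_function_mult local_function_diff loc)
  also have "\<dots> = 0"
    unfolding paired sum_distrib_left[symmetric] telescope by simp
  finally show ?thesis
    by (simp add: j_def)
qed

lemma integral_square_gradient_pos:
  assumes "0 < q" "q < 1"
  shows "0 < (\<integral>\<eta>. (of_bool (\<eta> 0) - of_bool (\<eta> 1))\<^sup>2 \<partial>equilibrium q :: real)"
proof -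
  let ?C = "\<lambda>\<eta>::config. \<forall>x\<in>{0, 1::int}. \<eta> x \<longleftrightarrow> x \<in> {0}"
  have "0 < (\<Prod>x\<in>{0, 1::int}. if x \<in> {0} then 1 - q else q)"
    using assms by simp
  also have "\<dots> = (\<integral>\<eta>. of_bool (?C \<eta>) \<partial>equilibrium q)"
    using assms by (intro integral_cylinder[symmetric]) simp_all
  also have "\<dots> \<le> (\<integral>\<eta>. (of_bool (\<eta> 0) - of_bool (\<eta> 1))\<^sup>2 \<partial>equilibrium q)"
  proof (rule integral_mono)
    show "integrable (equilibrium q) (\<lambda>\<eta>. of_bool (?C \<eta>) :: real)"
      by (intro local_function_integrable local_function_cylinder) simp
    show "integrable (equilibrium q) (\<lambda>\<eta>. (of_bool (\<eta> 0) - of_bool (\<eta> 1))\<^sup>2 :: real)"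
      by (intro local_function_integrable local_function_power local_function_diff local_function_site)
  qed auto
  finally show ?thesis .
qed

subsection \<open>Lower bound for the Green-Kubo functional\<close>

text \<open>By translation invariance the facilitated energy of every bond equals that of the bond
  of 0 and 1, so a single bound \<open>J\<close> serves the whole path.\<close>

lemma current_estimate_right:
  assumes q: "0 < q" "q < 1" "1 - q \<le> (1 / 8) ^ (2 * (r + 1))"
    and f: "local_function f"
    and J: "(\<integral>\<eta>. of_bool (vacant_right r 0 \<eta>) * (current f 0 \<eta>)\<^sup>2 \<partial>equilibrium q) \<le> J" "0 \<le> J"
  shows "(\<integral>\<eta>. \<bar>current f 0 \<eta>\<bar> \<partial>equilibrium q) \<le> 8 * 8 ^ r * sqrt J"
proof (rule gradient_estimate[OF q local_function_current[OF f] J(2)])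
  fix n
  obtain \<Phi> where \<Phi>: "local_function \<Phi>"
    "\<And>x \<eta>. \<bar>x\<bar> \<le> int n + 1 \<Longrightarrow> \<Phi> (exchange x (x + 1) \<eta>) - \<Phi> \<eta> = current f x \<eta>"
    using f by (rule current_potential) (rule that)
  show "\<exists>\<Phi>. local_function \<Phi> \<and> (\<forall>\<eta>. \<Phi> (exchange 0 1 \<eta>) - \<Phi> \<eta> = current f 0 \<eta>) \<and>
      (\<forall>x\<in>{0..<2 + int n}. (\<integral>\<eta>. of_bool (vacant_right r x \<eta>) *
         (\<Phi> (exchange x (x + 1) \<eta>) - \<Phi> \<eta>)\<^sup>2 \<partial>equilibrium q) \<le> J)"
  proof (intro exI[of _ \<Phi>] conjI ballI allI \<Phi>(1))
    show "\<Phi> (exchange 0 1 \<eta>) - \<Phi> \<eta> = current f 0 \<eta>" for \<eta>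
      using \<Phi>(2)[of 0 \<eta>] by simp
    fix x assume x: "x \<in> {0..<2 + int n}"
    let ?F = "\<lambda>\<eta>. of_bool (vacant_right r 0 \<eta>) * (current f 0 \<eta>)\<^sup>2"
    have "of_bool (vacant_right r x \<eta>) * (\<Phi> (exchange x (x + 1) \<eta>) - \<Phi> \<eta>)\<^sup>2 = ?F (shift (- x) \<eta>)"
      for \<eta>
    proof -
      have img: "{x + 2..x + 1 + int r} = (\<lambda>k. k + x) ` {0 + 2..0 + 1 + int r}"
        by (simp add: add.commute add.left_commute)
      have "vacant_right r x \<eta> \<longleftrightarrow> vacant_right r 0 (shift (- x) \<eta>)"
        unfolding vacant_right_def shift_def img by (simp only: Set.ball_simps(9) diff_minus_eq_add)
      moreover have "\<Phi> (exchange x (x + 1) \<eta>) - \<Phi> \<eta> = current f 0 (shift (- x) \<eta>)"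
        using \<Phi>(2)[of x \<eta>] x current_shift[of f x \<eta>] by simp
      ultimately show ?thesis
        by (simp only:)
    qed
    then have "(\<integral>\<eta>. of_bool (vacant_right r x \<eta>) *
         (\<Phi> (exchange x (x + 1) \<eta>) - \<Phi> \<eta>)\<^sup>2 \<partial>equilibrium q) = (\<integral>\<eta>. ?F (shift (- x) \<eta>) \<partial>equilibrium q)"
      by (simp only:)
    also have "\<dots> = (\<integral>\<eta>. ?F \<eta> \<partial>equilibrium q)"
      by (rule integral_equilibrium_shift)
        (intro local_function_mult local_function_vacant_right local_function_power
          local_function_current f)
    finally show "(\<integral>\<eta>. of_bool (vacant_right r x \<eta>) *
         (\<Phi> (exchange x (x + 1) \<eta>) - \<Phi> \<eta>)\<^sup>2 \<partial>equilibrium q) \<le> J"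
      using J(1) by simp
  qed
qed

text \<open>The image of \<open>vacant_right r 0\<close> under the reflection of \<open>u\<close> to
  \<open>1 - u\<close>. Other bonds are reached by reflecting and translating.\<close>

definition vacant_left :: "nat \<Rightarrow> config \<Rightarrow> bool" where
  "vacant_left r \<eta> \<longleftrightarrow> (\<forall>k\<in>{- int r..-1}. \<not> \<eta> k)"

lemma local_function_vacant_left: "local_function (\<lambda>\<eta>. of_bool (vacant_left r \<eta>))"
  unfolding vacant_left_def by (rule local_function_cylinder) simp

text \<open>The reflection \<open>u \<mapsto> 1 - u\<close> fixes the bond \<open>{0, 1}\<close> and reverses the direction of the facilitation.\<close>

lemma current_estimate_left:
  assumes q: "0 < q" "q < 1" "1 - q \<le> (1 / 8) ^ (2 * (r + 1))"
    and f: "local_function f"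
    and J: "(\<integral>\<eta>. of_bool (vacant_left r \<eta>) * (current f 0 \<eta>)\<^sup>2 \<partial>equilibrium q) \<le> J" "0 \<le> J"
  shows "(\<integral>\<eta>. \<bar>current f 0 \<eta>\<bar> \<partial>equilibrium q) \<le> 8 * 8 ^ r * sqrt J"
proof -
  let ?R = "\<lambda>(\<eta>::config) u. \<eta> (1 - u)"
  let ?F = "\<lambda>\<eta>. of_bool (vacant_left r \<eta>) * (current f 0 \<eta>)\<^sup>2"
  \<comment> \<open>Used with \<open>a = 1\<close> for the reflection and with
    \<open>a = 1 + x\<close> for the reflection followed by a translation.\<close>
  have bij: "bij (\<lambda>u::int. a - u)" for a
    by (rule bij_betw_byWitness[where f' = "\<lambda>u. a - u"]) auto
  have F: "local_function ?F"
    by (intro local_function_mult local_function_vacant_left local_function_power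
        local_function_current f)
  have "(\<integral>\<eta>. \<bar>current f 0 (?R \<eta>)\<bar> \<partial>equilibrium q) \<le> 8 * 8 ^ r * sqrt J"
  proof (rule gradient_estimate[OF q _ J(2)])
    show "local_function (\<lambda>\<eta>. current f 0 (?R \<eta>))"
      by (rule local_function_reindex) (rule local_function_current[OF f])
    fix n
    obtain \<Phi> where \<Phi>: "local_function \<Phi>"
      "\<And>x \<eta>. \<bar>x\<bar> \<le> int n + 1 \<Longrightarrow> \<Phi> (exchange x (x + 1) \<eta>) - \<Phi> \<eta> = current f x \<eta>"
      using f by (rule current_potential) (rule that)
    have grad: "\<Phi> (?R (exchange x (x + 1) \<eta>)) - \<Phi> (?R \<eta>) = current f 0 (shift x (?R \<eta>))"
      if "\<bar>x\<bar> \<le> int n + 1" for x \<eta>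
    proof -
      have "?R (exchange x (x + 1) \<eta>) = exchange (- x) (- x + 1) (?R \<eta>)"
        by (auto simp: exchange_def fun_eq_iff add.commute[of 1])
      then show ?thesis
        using \<Phi>(2)[of "- x" "?R \<eta>"] that current_shift[of f "- x" "?R \<eta>"] by simp
    qed
    show "\<exists>\<Phi>. local_function \<Phi> \<and> (\<forall>\<eta>. \<Phi> (exchange 0 1 \<eta>) - \<Phi> \<eta> = current f 0 (?R \<eta>)) \<and>
        (\<forall>x\<in>{0..<2 + int n}. (\<integral>\<eta>. of_bool (vacant_right r x \<eta>) *
           (\<Phi> (exchange x (x + 1) \<eta>) - \<Phi> \<eta>)\<^sup>2 \<partial>equilibrium q) \<le> J)"
    proof (intro exI[of _ "\<lambda>\<eta>. \<Phi> (?R \<eta>)"] conjI ballI allI)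
      show "local_function (\<lambda>\<eta>. \<Phi> (?R \<eta>))"
        by (rule local_function_reindex) (rule \<Phi>(1))
      have shift0: "shift 0 \<eta> = \<eta>" for \<eta>
        by (simp add: shift_def)
      show "\<Phi> (?R (exchange 0 1 \<eta>)) - \<Phi> (?R \<eta>) = current f 0 (?R \<eta>)" for \<eta>
        using grad[of 0 \<eta>] unfolding shift0 by simp
      fix x assume x: "x \<in> {0..<2 + int n}"
      have "of_bool (vacant_right r x \<eta>) * (\<Phi> (?R (exchange x (x + 1) \<eta>)) - \<Phi> (?R \<eta>))\<^sup>2 =
          ?F (\<lambda>u. \<eta> (1 + x - u))" for \<eta>
      proof -
        have "vacant_right r x \<eta> \<longleftrightarrow> vacant_left r (\<lambda>u. \<eta> (1 + x - u))"
        proof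
          assume "vacant_right r x \<eta>"
          then show "vacant_left r (\<lambda>u. \<eta> (1 + x - u))"
            by (auto simp: vacant_right_def vacant_left_def)
        next
          assume *: "vacant_left r (\<lambda>u. \<eta> (1 + x - u))"
          have "\<not> \<eta> k" if "k \<in> {x + 2..x + 1 + int r}" for k
            using *[unfolded vacant_left_def, THEN bspec, of "1 + x - k"] that by auto
          then show "vacant_right r x \<eta>"
            unfolding vacant_right_def by blast
        qed
        moreover have "shift x (?R \<eta>) = (\<lambda>u. \<eta> (1 + x - u))"
          by (simp add: shift_def algebra_simps)
        moreover have "\<Phi> (?R (exchange x (x + 1) \<eta>)) - \<Phi> (?R \<eta>) = current f 0 (shift x (?R \<eta>))"
          using grad[of x \<eta>] x by simp
        ultimately show ?thesis
          by (simp only:)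
      qed
      then have "(\<integral>\<eta>. of_bool (vacant_right r x \<eta>) *
           (\<Phi> (?R (exchange x (x + 1) \<eta>)) - \<Phi> (?R \<eta>))\<^sup>2 \<partial>equilibrium q) =
          (\<integral>\<eta>. ?F (\<lambda>u. \<eta> (1 + x - u)) \<partial>equilibrium q)"
        by (simp only:)
      also have "\<dots> = (\<integral>\<eta>. ?F \<eta> \<partial>equilibrium q)"
        by (rule integral_equilibrium_reindex[OF bij F])
      finally show "(\<integral>\<eta>. of_bool (vacant_right r x \<eta>) *
           (\<Phi> (?R (exchange x (x + 1) \<eta>)) - \<Phi> (?R \<eta>))\<^sup>2 \<partial>equilibrium q) \<le> J"
        using J(1) by simp
    qed
  qed
  moreover have "(\<integral>\<eta>. \<bar>current f 0 (?R \<eta>)\<bar> \<partial>equilibrium q) = (\<integral>\<eta>. \<bar>current f 0 \<eta>\<bar> \<partial>equilibrium q)"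
    by (rule integral_equilibrium_reindex[OF bij])
      (intro local_function_abs local_function_current f)
  ultimately show ?thesis
    by simp
qed

section \<open>Rates of the lattice gas and the bound on the functional\<close>

context kclg
begin

lemma local_function_rate: "local_function (c x y)"
proof -
  obtain \<rho> where \<rho>: "\<forall>x y \<eta> \<omega>. (\<forall>u\<in>{x - \<rho>..x + \<rho>}. \<eta> u = \<omega> u) \<longrightarrow> c x y \<eta> = c x y \<omega>"
    using finite_range by blast
  show ?thesis
    by (rule local_functionI[of "{x - \<rho>..x + \<rho>}"], simp,
        rule \<rho>[THEN spec, THEN spec, THEN spec, THEN spec, THEN mp], blast)
qed

text \<open>Emptying sites can only raise the rate, the endpoints do not influence it, and sites
  beyond the range are invisible. So it suffices that \<open>\<eta>\<close> is vacant off
  \<open>B\<close> within the range; \<open>u - 1\<close> appears because \<open>B\<close> is placed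
  relative to the bond of -1 and 0.\<close>

lemma rate_cutoff:
  assumes \<rho>: "\<forall>x y \<eta> \<omega>. (\<forall>u\<in>{x - \<rho>..x + \<rho>}. \<eta> u = \<omega> u) \<longrightarrow> c x y \<eta> = c x y \<omega>"
    and vac: "\<And>u. u \<in> {- \<rho>..\<rho>} \<Longrightarrow> u \<notin> {0, 1} \<Longrightarrow> u - 1 \<notin> B \<Longrightarrow> \<not> \<eta> u"
  shows "c (-1) 0 (filled_on B) \<le> c 0 1 \<eta>"
proof -
  define \<zeta> where "\<zeta> = shift (-1) \<eta>"
  let ?\<zeta>' = "\<lambda>u. u \<in> B \<and> \<zeta> u"
  let ?\<zeta>'' = "?\<zeta>'(-1 := \<zeta> (-1), 0 := \<zeta> 0)"
  have "c (-1) 0 (filled_on B) \<le> c (-1) 0 ?\<zeta>'"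
    by (rule antitone) (auto simp: filled_on_def le_fun_def)
  also have "\<dots> = c (-1) 0 ?\<zeta>''"
    by (rule endpoint_independent) simp
  also have "\<dots> = c (-1) 0 \<zeta>"
  proof (rule \<rho>[THEN spec, THEN spec, THEN spec, THEN spec, THEN mp], rule ballI)
    fix u assume "u \<in> {-1 - \<rho>..-1 + \<rho>}"
    then show "?\<zeta>'' u = \<zeta> u"
      using vac[of "u + 1"] by (cases "u \<in> B") (auto simp: \<zeta>_def shift_def)
  qed
  also have "\<dots> = c 0 1 \<eta>"
    using translation_invariant[of 0 1 \<eta> "-1"] by (simp add: \<zeta>_def)
  finally show ?thesis .
qed

text \<open>The constant is whichever half-line rate is positive. With the left half-line filled,
  the vacancies required lie in the range to the right of the bond; with the right half-line filled,
  to its left.\<close>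

lemma one_sided_rate:
  assumes "one_sided c"
  obtains r c\<^sub>0 where "0 < c\<^sub>0"
    "(\<forall>\<eta>. vacant_right r 0 \<eta> \<longrightarrow> c\<^sub>0 \<le> c 0 1 \<eta>) \<or> (\<forall>\<eta>. vacant_left r \<eta> \<longrightarrow> c\<^sub>0 \<le> c 0 1 \<eta>)"
proof -
  obtain \<rho> where \<rho>: "0 < \<rho>"
    "\<forall>x y \<eta> \<omega>. (\<forall>u\<in>{x - \<rho>..x + \<rho>}. \<eta> u = \<omega> u) \<longrightarrow> c x y \<eta> = c x y \<omega>"
    using finite_range by blast
  have "c (-1) 0 (filled_on {..-1}) \<le> c 0 1 \<eta>" if "vacant_right (nat \<rho>) 0 \<eta>" for \<eta>
    by (rule rate_cutoff[OF \<rho>(2)]) (use that in \<open>auto simp: vacant_right_def\<close>)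
  moreover have "c (-1) 0 (filled_on {0..}) \<le> c 0 1 \<eta>" if "vacant_left (nat \<rho>) \<eta>" for \<eta>
    by (rule rate_cutoff[OF \<rho>(2)]) (use that in \<open>auto simp: vacant_left_def\<close>)
  moreover have "0 < c (-1) 0 (filled_on {..-1}) \<or> 0 < c (-1) 0 (filled_on {0..})"
    using assms nonneg unfolding one_sided_def by (metis less_le)
  ultimately show thesis
    using that[of _ "nat \<rho>"] by blast
qed

text \<open>The mean of \<open>\<bar>current f 0\<bar>\<close> is squeezed between
  \<open>?P\<close>, which does not depend on \<open>f\<close>, and
  \<open>?K * sqrt (?I / c\<^sub>0)\<close>; solving for \<open>?I\<close> gives a bound uniform in
  \<open>f\<close>.\<close>

lemma Green_Kubo_lower_bound:
  assumes q: "0 < q" "q < 1" "1 - q \<le> (1 / 8) ^ (2 * (r + 1))"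
    and f: "local_function f"
    and "0 < c\<^sub>0"
    and rate: "(\<forall>\<eta>. vacant_right r 0 \<eta> \<longrightarrow> c\<^sub>0 \<le> c 0 1 \<eta>) \<or> (\<forall>\<eta>. vacant_left r \<eta> \<longrightarrow> c\<^sub>0 \<le> c 0 1 \<eta>)"
  shows "c\<^sub>0 * ((\<integral>\<eta>. (of_bool (\<eta> 0) - of_bool (\<eta> 1))\<^sup>2 \<partial>equilibrium q) / (8 * 8 ^ r))\<^sup>2 \<le>
    (\<integral>\<eta>. c 0 1 \<eta> * (current f 0 \<eta>)\<^sup>2 \<partial>equilibrium q)"
    (is "c\<^sub>0 * (?P / ?K)\<^sup>2 \<le> ?I")
proof -
  let ?j = "\<lambda>\<eta>::config. of_bool (\<eta> 0) - of_bool (\<eta> 1) :: real"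
  have I: "0 \<le> ?I / c\<^sub>0"
    using \<open>0 < c\<^sub>0\<close> nonneg by simp
  have weighted: "(\<integral>\<eta>. of_bool (V \<eta>) * (current f 0 \<eta>)\<^sup>2 \<partial>equilibrium q) \<le> ?I / c\<^sub>0"
    if V: "local_function (\<lambda>\<eta>. of_bool (V \<eta>))" and le: "\<forall>\<eta>. V \<eta> \<longrightarrow> c\<^sub>0 \<le> c 0 1 \<eta>" for V
  proof -
    have "c\<^sub>0 * (\<integral>\<eta>. of_bool (V \<eta>) * (current f 0 \<eta>)\<^sup>2 \<partial>equilibrium q) =
        (\<integral>\<eta>. c\<^sub>0 * (of_bool (V \<eta>) * (current f 0 \<eta>)\<^sup>2) \<partial>equilibrium q)"
      by simp
    also have "\<dots> \<le> ?I"
    proof (rule integral_mono)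
      show "integrable (equilibrium q) (\<lambda>\<eta>. c\<^sub>0 * (of_bool (V \<eta>) * (current f 0 \<eta>)\<^sup>2))"
        by (intro local_function_integrable local_function_mult local_function_const V
            local_function_power local_function_current f)
      show "integrable (equilibrium q) (\<lambda>\<eta>. c 0 1 \<eta> * (current f 0 \<eta>)\<^sup>2)"
        by (intro local_function_integrable local_function_mult local_function_rate
            local_function_power local_function_current f)
      show "c\<^sub>0 * (of_bool (V \<eta>) * (current f 0 \<eta>)\<^sup>2) \<le> c 0 1 \<eta> * (current f 0 \<eta>)\<^sup>2" for \<eta>
        using le nonneg[of 0 1 \<eta>] by (cases "V \<eta>") (auto intro: mult_right_mono)
    qed
    finally show ?thesis
      using \<open>0 < c\<^sub>0\<close> by (simp add: field_simps)
  qed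
  have "?P = (\<integral>\<eta>. ?j \<eta> * current f 0 \<eta> \<partial>equilibrium q)"
    by (rule integral_current[OF f, symmetric])
  also have "\<dots> \<le> (\<integral>\<eta>. \<bar>current f 0 \<eta>\<bar> \<partial>equilibrium q)"
  proof (rule integral_mono)
    show "integrable (equilibrium q) (\<lambda>\<eta>. ?j \<eta> * current f 0 \<eta>)"
      by (intro local_function_integrable local_function_mult local_function_diff local_function_site
          local_function_current f)
    show "integrable (equilibrium q) (\<lambda>\<eta>. \<bar>current f 0 \<eta>\<bar>)"
      by (intro local_function_integrable local_function_abs local_function_current f)
    \<comment> \<open>The gradient of the occupation number has absolute value at most 1.\<close>
    show "?j \<eta> * current f 0 \<eta> \<le> \<bar>current f 0 \<eta>\<bar>" for \<eta>
      by (cases "\<eta> 0"; cases "\<eta> 1") auto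
  qed
  also have "\<dots> \<le> ?K * sqrt (?I / c\<^sub>0)"
    using rate
  proof
    assume "\<forall>\<eta>. vacant_right r 0 \<eta> \<longrightarrow> c\<^sub>0 \<le> c 0 1 \<eta>"
    then show ?thesis
      by (intro current_estimate_right q f I weighted local_function_vacant_right)
  next
    assume "\<forall>\<eta>. vacant_left r \<eta> \<longrightarrow> c\<^sub>0 \<le> c 0 1 \<eta>"
    then show ?thesis
      by (intro current_estimate_left q f I weighted local_function_vacant_left)
  qed
  finally have "?P / ?K \<le> sqrt (?I / c\<^sub>0)"
    by (simp add: field_simps)
  then have "(?P / ?K)\<^sup>2 \<le> (sqrt (?I / c\<^sub>0))\<^sup>2"
    by (intro power_mono) simp_all
  then have "(?P / ?K)\<^sup>2 \<le> ?I / c\<^sub>0"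
    using I by simp
  then show ?thesis
    using \<open>0 < c\<^sub>0\<close> by (simp add: pos_le_divide_eq mult.commute)
qed

end

theorem theorem2p5:
  fixes c :: "int \<Rightarrow> int \<Rightarrow> config \<Rightarrow> real"
  assumes "kclg c"
    and "one_sided c"
  shows "\<exists>q\<^sub>0\<in>{0<..<1}. \<forall>q\<in>{q\<^sub>0<..<1}. diffusion_coefficient c q > 0"
proof -
  interpret kclg c by (rule assms)
  obtain r c\<^sub>0 where rate: "0 < c\<^sub>0"
    "(\<forall>\<eta>. vacant_right r 0 \<eta> \<longrightarrow> c\<^sub>0 \<le> c 0 1 \<eta>) \<or> (\<forall>\<eta>. vacant_left r \<eta> \<longrightarrow> c\<^sub>0 \<le> c 0 1 \<eta>)"
    using one_sided_rate[OF assms(2)] .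
  \<comment> \<open>Exactly the density threshold under which the sum over stopping patterns
    converges geometrically.\<close>
  define q\<^sub>0 :: real where "q\<^sub>0 = 1 - (1 / 8) ^ (2 * (r + 1))"
  have "(1 / 8 :: real) ^ (2 * (r + 1)) < 1"
    by (intro power_less_one_iff[THEN iffD2]) simp_all
  then have q\<^sub>0: "q\<^sub>0 \<in> {0<..<1}"
    by (simp add: q\<^sub>0_def)
  have "0 < diffusion_coefficient c q" if "q \<in> {q\<^sub>0<..<1}" for q
  proof -
    have q: "0 < q" "q < 1" "1 - q \<le> (1 / 8) ^ (2 * (r + 1))"
      using that q\<^sub>0 by (auto simp: q\<^sub>0_def)
    let ?b = "c\<^sub>0 * ((\<integral>\<eta>. (of_bool (\<eta> 0) - of_bool (\<eta> 1))\<^sup>2 \<partial>equilibrium q) / (8 * 8 ^ r))\<^sup>2 :: real"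
    have "0 < ?b"
      using rate(1) integral_square_gradient_pos[OF q(1,2)] by simp
    \<comment> \<open>The bound is free of \<open>f\<close>, so it passes to the infimum; over the
      reals this also requires the index set to be nonempty.\<close>
    also have "?b \<le> (INF f\<in>{f. local_function f}. \<integral>\<eta>. c 0 1 \<eta> * (current f 0 \<eta>)\<^sup>2 \<partial>equilibrium q)"
    proof (rule cINF_greatest)
      show "{f :: config \<Rightarrow> real. local_function f} \<noteq> {}"
        using local_function_const by blast
    qed (use Green_Kubo_lower_bound[OF q _ rate] in simp)
    finally show ?thesis
      using q by (simp add: diffusion_coefficient_def current_def)
  qed
  then show ?thesis
    using q\<^sub>0 by blast
qed

end
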